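(* Let $0<\gamma<1$ be a quadratic irrational with continued fraction $$\gamma=[0,a_1,a_2,\ldots,a_P,a_1,a_2,\ldots,a_P,a_1,a_2,\ldots,a_P,\ldots]$$ for some $P\ge 1$ and positive integers $a_1,\dots,a_P$. Let $\alpha,\beta\in\mathbb{Q}(\gamma)$ be such that $\alpha\ge 0$ and $\alpha+\beta\ge 0$. Then the sequence $(\lfloor n\alpha+\beta\rfloor)_{n\ge 1}$ is $\gamma$-Ostrowski synchronized.
   Context: Let $0<\gamma<1$ be irrational with continued fraction $[a_0,a_1,a_2,\ldots]$, $a_0=0$. Define $p_i=a_ip_{i-1}+p_{i-2}$, $q_i=a_iq_{i-1}+q_{i-2}$ for $i\ge 0$, with $p_{-2}=q_{-1}=0$ and $q_{-2}=p_{-1}=1$. Every natural number $n$ (including $0$) can be written uniquely (up to leading zeros) as $n=\sum_{0\le i\le t}e_iq_i$ with integers $e_i$ satisfying: (a) $0\le e_i\le a_{i+1}$ for $i\ge 1$; (b) for $i\ge 1$, $e_i=a_{i+1}$ implies $e_{i-1}=0$; (c) $0\le e_0<a_1$. The word $(n)_\gamma=e_te_{t-1}\cdots e_0$ (most significant digit first, no leading zeros) is the (canonical) Ostrowski $\gamma$-representation of $n$. A pair $(n,y)$ of natural numbers is represented as a word over pairs of digits by padding the shorter of $(n)_\gamma,(y)_\gamma$ with leading zeros to equal length and reading both in parallel. A sequence $(s_n)_{n\ge 1}$ of natural numbers is $\gamma$-Ostrowski synchronized if there is a finite automaton that, reading the Ostrowski $\gamma$-representations of $n\geq 1$ and of a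 natural number $y$ in parallel, accepts if and only if $y=s_n$. *)

theory Defs
  imports Complex_Main "HOL-Algebra.Generated_Fields" "HOL-Algebra.Algebraic_Closure_Type"
begin

definition quadratic_irrational :: "real \<Rightarrow> bool" where
  "quadratic_irrational x \<longleftrightarrow>
     x \<notin> \<rat> \<and> (\<exists>a b c :: int. a \<noteq> 0 \<and> of_int a * x\<^sup>2 + of_int b * x + of_int c = 0)"

text \<open>The field \<open>\<rat>(x)\<close>, as a subset of the reals. Every subfield of the reals contains
  the rationals, so generating from \<open>x\<close> alone suffices.\<close>

definition rat_adjoin :: "real \<Rightarrow> real set" where
  "rat_adjoin x = generate_field ring_of_type_algebra {x}"

text \<open>The partial quotients are \<open>\<lfloor>x\<^sub>i\<rfloor>\<close>, where \<open>x\<^sub>0 = x\<close> and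
  \<open>x\<^sub>i\<^sub>+\<^sub>1 = 1 / (x\<^sub>i - \<lfloor>x\<^sub>i\<rfloor>)\<close>. They are natural numbers for \<open>x \<ge> 0\<close>, and for irrational \<open>x\<close>
  the process never divides by zero.\<close>

fun complete_quotient :: "real \<Rightarrow> nat \<Rightarrow> real" where
  "complete_quotient x 0 = x"
| "complete_quotient x (Suc i) = 1 / frac (complete_quotient x i)"

definition partial_quotient :: "real \<Rightarrow> nat \<Rightarrow> nat" where
  "partial_quotient x i = nat \<lfloor>complete_quotient x i\<rfloor>"

text \<open>The denominators \<open>q\<^sub>i\<close> for \<open>i \<ge> 0\<close>. The recurrence started at \<open>q\<^sub>-\<^sub>2 = 1\<close> and
  \<open>q\<^sub>-\<^sub>1 = 0\<close> gives \<open>q\<^sub>0 = 1\<close> and \<open>q\<^sub>1 = a\<^sub>1\<close>.\<close>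

fun convergent_denom :: "real \<Rightarrow> nat \<Rightarrow> nat" where
  "convergent_denom x 0 = 1"
| "convergent_denom x (Suc 0) = partial_quotient x 1"
| "convergent_denom x (Suc (Suc i)) =
     partial_quotient x (Suc (Suc i)) * convergent_denom x (Suc i) + convergent_denom x i"

text \<open>Words have the most significant digit first, so the digit \<open>e\<^sub>i\<close> of a word \<open>w\<close> is
  \<open>rev w ! i\<close>. The number 0 is represented by the empty word.\<close>

definition is_ostrowski_rep :: "real \<Rightarrow> nat \<Rightarrow> nat list \<Rightarrow> bool" where
  "is_ostrowski_rep \<gamma> n w \<longleftrightarrow>
     (let e = (\<lambda>i. rev w ! i); t = length w in
        n = (\<Sum>i<t. e i * convergent_denom \<gamma> i) \<and>
        (\<forall>i. 1 \<le> i \<and> i < t \<longrightarrow> e i \<le> partial_quotient \<gamma> (i + 1)) \<and>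
        (\<forall>i. 1 \<le> i \<and> i < t \<and> e i = partial_quotient \<gamma> (i + 1) \<longrightarrow> e (i - 1) = 0) \<and>
        (0 < t \<longrightarrow> e 0 < partial_quotient \<gamma> 1) \<and>
        (w \<noteq> [] \<longrightarrow> hd w \<noteq> 0))"

definition ostrowski_rep :: "real \<Rightarrow> nat \<Rightarrow> nat list" where
  "ostrowski_rep \<gamma> n = (THE w. is_ostrowski_rep \<gamma> n w)"

definition pad_zeros :: "nat \<Rightarrow> nat list \<Rightarrow> nat list" where
  "pad_zeros k w = replicate (k - length w) 0 @ w"

definition ostrowski_pair_rep :: "real \<Rightarrow> nat \<Rightarrow> nat \<Rightarrow> (nat \<times> nat) list" where
  "ostrowski_pair_rep \<gamma> n y =
     (let u = ostrowski_rep \<gamma> n; v = ostrowski_rep \<gamma> y; k = max (length u) (length v)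
      in zip (pad_zeros k u) (pad_zeros k v))"

record ('s, 'l) dfa =
  alphabet :: "'l set"
  states :: "'s set"
  start :: 's
  trans :: "'s \<Rightarrow> 'l \<Rightarrow> 's"
  accepting :: "'s set"

definition is_dfa :: "('s, 'l) dfa \<Rightarrow> bool" where
  "is_dfa A \<longleftrightarrow>
     finite (alphabet A) \<and> finite (states A) \<and>
     start A \<in> states A \<and> accepting A \<subseteq> states A \<and>
     (\<forall>s \<in> states A. \<forall>l \<in> alphabet A. trans A s l \<in> states A)"

definition accepts :: "('s, 'l) dfa \<Rightarrow> 'l list \<Rightarrow> bool" where
  "accepts A w \<longleftrightarrow> w \<in> lists (alphabet A) \<and> foldl (trans A) (start A) w \<in> accepting A"

text \<open>Taking the states to be natural numbers is no restriction, since an automaton has only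
  finitely many. The sequence is indexed from 1, so the value \<open>s 0\<close> is ignored.\<close>

definition ostrowski_synchronized :: "real \<Rightarrow> (nat \<Rightarrow> nat) \<Rightarrow> bool" where
  "ostrowski_synchronized \<gamma> s \<longleftrightarrow>
     (\<exists>A :: (nat, nat \<times> nat) dfa. is_dfa A \<and>
        (\<forall>n \<ge> 1. \<forall>y.
           ostrowski_pair_rep \<gamma> n y \<in> lists (alphabet A) \<and>
           (accepts A (ostrowski_pair_rep \<gamma> n y) \<longleftrightarrow> y = s n)))"

end

theory Submission
  imports Defs
begin

text \<open>
  Let \<open>\<delta>\<^sub>i = q\<^sub>i\<gamma> - p\<^sub>i\<close>. By periodicity \<open>q\<^sub>i\<^sub>+\<^sub>P = \<lambda>q\<^sub>i - \<kappa>\<delta>\<^sub>i\<close> with \<open>\<kappa> = q\<^sub>P\<^sub>-\<^sub>1\<close> and \<open>\<lambda> = q\<^sub>P + \<kappa>\<gamma>\<close>.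
  Hence, for \<open>n = \<Sum>e\<^sub>iq\<^sub>i\<close>, \<open>y = \<Sum>f\<^sub>iq\<^sub>i\<close> and a common denominator \<open>D\<close> of the coefficients of \<open>\<alpha>\<close> and \<open>\<beta>\<close>,
  the number \<open>\<kappa>D(n\<alpha> + \<beta> - y)\<close> splits as \<open>N + R\<close>, where \<open>N\<close> is an integral linear combination of
  the \<open>q\<^sub>i\<close> and \<open>q\<^sub>i\<^sub>+\<^sub>P\<close>, and \<open>R\<close> is a combination of the \<open>\<delta>\<^sub>i\<close> plus a constant. As \<open>\<Sum>|\<delta>\<^sub>i|\<close> converges,
  \<open>R\<close> is bounded, so \<open>y = \<lfloor>n\<alpha> + \<beta>\<rfloor>\<close> says that \<open>N = m\<close> and \<open>0 \<le> m + R < \<kappa>D\<close> for one of finitely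
  many integers \<open>m\<close>.

  Both conditions are checked with finitely many states, reading the least significant digit
  first. Cut a word at position \<open>i\<close>. Each half contributes \<open>xq\<^sub>i + yq\<^sub>i\<^sub>-\<^sub>1\<close>, respectively
  \<open>x\<delta>\<^sub>i + y\<delta>\<^sub>i\<^sub>-\<^sub>1\<close>, with integers \<open>x\<close>, \<open>y\<close>. Unless the outcome is already decided, both
  linear forms \<open>xq\<^sub>i + yq\<^sub>i\<^sub>-\<^sub>1 = O(q\<^sub>i)\<close> and \<open>x\<delta>\<^sub>i + y\<delta>\<^sub>i\<^sub>-\<^sub>1 = O(\<delta>\<^sub>i\<^sub>-\<^sub>1)\<close> are small, one because of the
  digits already read and the other because of those still to come. As \<open>\<delta>\<^sub>i\<close> and \<open>\<delta>\<^sub>i\<^sub>-\<^sub>1\<close> have opposite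
  signs, this bounds \<open>x\<close> and \<open>y\<close>.
\<close>

subsection \<open>Words with finitely many residuals\<close>

text \<open>Residuals are the Myhill-Nerode classes. Working with them rather than with automata
  reduces closure under Boolean operations to pairing finite maps.\<close>

definition residual :: "'l set \<Rightarrow> ('l list \<Rightarrow> bool) \<Rightarrow> 'l list \<Rightarrow> 'l list set" where
  "residual \<Sigma> R u = {z \<in> lists \<Sigma>. R (u @ z)}"

definition finite_index :: "'l set \<Rightarrow> ('l list \<Rightarrow> bool) \<Rightarrow> bool" where
  "finite_index \<Sigma> R \<longleftrightarrow> finite (residual \<Sigma> R ` lists \<Sigma>)"

text \<open>Swapping \<open>u\<close> and \<open>u'\<close> turns the one-sided hypothesis into
  equality of residuals, so the residual of \<open>u\<close> is a function of \<open>g u\<close>.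
  Later \<open>g\<close> plays the part of the state reached, without any transition function being
  written down.\<close>

lemma finite_index_factor:
  assumes "finite (g ` lists \<Sigma>)"
    and "\<And>u u' z. \<lbrakk>u \<in> lists \<Sigma>; u' \<in> lists \<Sigma>; z \<in> lists \<Sigma>; g u = g u'; R (u @ z)\<rbrakk> \<Longrightarrow> R (u' @ z)"
  shows "finite_index \<Sigma> R"
proof -
  define h where "h c = residual \<Sigma> R (SOME u. u \<in> lists \<Sigma> \<and> g u = c)" for c
  have "residual \<Sigma> R u = h (g u)" if u: "u \<in> lists \<Sigma>" for u
  proof -
    define v where "v = (SOME v. v \<in> lists \<Sigma> \<and> g v = g u)"
    have v: "v \<in> lists \<Sigma> \<and> g v = g u"
      unfolding v_def by (rule someI[where x = u]) (simp add: u)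
    then have "residual \<Sigma> R u = residual \<Sigma> R v"
      unfolding residual_def using u assms(2)[of u v] assms(2)[of v u] by auto
    then show ?thesis by (simp add: h_def v_def)
  qed
  then have "residual \<Sigma> R ` lists \<Sigma> = h ` g ` lists \<Sigma>"
    by (simp add: image_image cong: image_cong)
  then show ?thesis using assms(1) by (simp add: finite_index_def)
qed

lemma finite_index_const: "finite_index \<Sigma> (\<lambda>_. c)"
  by (rule finite_index_factor[where g = "\<lambda>_. ()"]) auto

lemma finite_index_not:
  assumes "finite_index \<Sigma> R"
  shows "finite_index \<Sigma> (\<lambda>u. \<not> R u)"
  by (rule finite_index_factor[where g = "residual \<Sigma> R"])
    (use assms in \<open>auto simp: finite_index_def residual_def\<close>)

lemma finite_index_conj:
  assumes "finite_index \<Sigma> R" "finite_index \<Sigma> S"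
  shows "finite_index \<Sigma> (\<lambda>u. R u \<and> S u)"
proof (rule finite_index_factor[where g = "\<lambda>u. (residual \<Sigma> R u, residual \<Sigma> S u)"])
  show "finite ((\<lambda>u. (residual \<Sigma> R u, residual \<Sigma> S u)) ` lists \<Sigma>)"
    by (rule finite_subset[of _ "(residual \<Sigma> R ` lists \<Sigma>) \<times> (residual \<Sigma> S ` lists \<Sigma>)"])
      (use assms in \<open>auto simp: finite_index_def\<close>)
qed (auto simp: residual_def)

lemma finite_index_disj:
  assumes "finite_index \<Sigma> R" "finite_index \<Sigma> S"
  shows "finite_index \<Sigma> (\<lambda>u. R u \<or> S u)"
  using finite_index_not[OF finite_index_conj[OF assms[THEN finite_index_not]]] by simp

lemma finite_index_Bex:
  assumes "finite M" "\<And>m. m \<in> M \<Longrightarrow> finite_index \<Sigma> (R m)"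
  shows "finite_index \<Sigma> (\<lambda>u. \<exists>m\<in>M. R m u)"
  using assms
  by (induction M rule: finite_induct) (auto intro: finite_index_const finite_index_disj)

text \<open>The state after a word \<open>w\<close> is the set of residuals that contain \<open>rev w\<close>, so the subset
  construction also reverses the reading direction.\<close>

lemma finite_index_dfa_rev:
  assumes fin: "finite \<Sigma>" and R: "finite_index \<Sigma> R"
  shows "\<exists>A :: (nat, 'l) dfa. is_dfa A \<and> alphabet A = \<Sigma> \<and>
    (\<forall>w \<in> lists \<Sigma>. accepts A w \<longleftrightarrow> R (rev w))"
proof -
  define C where "C = residual \<Sigma> R ` lists \<Sigma>"
  \<comment> \<open>\<open>dv l c\<close> is the left quotient by \<open>l\<close>. As
    \<open>rev (w @ [l]) = l # rev w\<close>, a residual contains the new reversed word iff its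
    quotient contains the old one; \<open>tr\<close> computes exactly this.\<close>
  define dv where "dv l c = {z \<in> lists \<Sigma>. l # z \<in> c}" for l and c :: "'l list set"
  define tr where "tr T l = {c \<in> C. dv l c \<in> T}" for T l
  define st where "st w = {c \<in> C. rev w \<in> c}" for w
  have finC: "finite C" using R by (simp add: C_def finite_index_def)
  then have "finite (Pow C)" by simp
  then obtain enc :: "'l list set set \<Rightarrow> nat" where enc: "inj_on enc (Pow C)"
    using finite_imp_inj_to_nat_seg by blast
  define dec where "dec = inv_into (Pow C) enc"
  have dec: "dec (enc T) = T" if "T \<subseteq> C" for T
    using that enc by (simp add: dec_def inv_into_f_f)
  define A :: "(nat, 'l) dfa" where
    "A = \<lparr>alphabet = \<Sigma>, states = enc ` Pow C, start = enc (st []),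
          trans = (\<lambda>s l. enc (tr (dec s) l)), accepting = {s \<in> enc ` Pow C. residual \<Sigma> R [] \<in> dec s}\<rparr>"
  have st_sub: "st w \<subseteq> C" for w by (auto simp: st_def)
  have dv_C: "dv l c \<in> C" if "c \<in> C" "l \<in> \<Sigma>" for l c
  proof -
    obtain u where u: "u \<in> lists \<Sigma>" "c = residual \<Sigma> R u" using \<open>c \<in> C\<close> by (auto simp: C_def)
    then have "dv l c = residual \<Sigma> R (u @ [l])" using that by (auto simp: dv_def residual_def)
    then show ?thesis unfolding C_def using u that by (intro image_eqI[of _ _ "u @ [l]"]) auto
  qed
  have tr_st: "tr (st w) l = st (w @ [l])" if "w \<in> lists \<Sigma>" "l \<in> \<Sigma>" for w l
    using that dv_C by (auto simp: tr_def st_def) (auto simp: dv_def)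
  have run: "foldl (trans A) (start A) w = enc (st w)" if "w \<in> lists \<Sigma>" for w
    using that
  proof (induction w rule: rev_induct)
    case Nil
    then show ?case by (simp add: A_def)
  next
    case (snoc l w)
    then show ?case using tr_st[of w l] dec[OF st_sub[of w]] by (simp add: A_def)
  qed
  have "is_dfa A"
    using fin finC by (auto simp: is_dfa_def A_def st_def tr_def)
  moreover have "accepts A w \<longleftrightarrow> R (rev w)" if w: "w \<in> lists \<Sigma>" for w
  proof -
    have "accepts A w \<longleftrightarrow> residual \<Sigma> R [] \<in> st w"
      using w run[OF w] dec[OF st_sub[of w]] st_sub[of w] by (auto simp: accepts_def A_def)
    also have "\<dots> \<longleftrightarrow> R (rev w)"
    proof -
      have "residual \<Sigma> R [] \<in> C" by (simp add: C_def)
      then show ?thesis using w by (simp add: st_def) (auto simp: residual_def)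
    qed
    finally show ?thesis .
  qed
  ultimately show ?thesis by (intro exI[of _ A]) (simp add: A_def)
qed

subsection \<open>Linear recurrences of a periodic continued fraction\<close>

text \<open>Indices are shifted by one to start the recurrences at \<open>-1\<close>: with \<open>b k = a\<^sub>k\<^sub>+\<^sub>1\<close> and
  \<open>\<theta> k\<close> the fractional part of the complete quotient \<open>k\<close>, these are \<open>q\<^sub>k\<^sub>-\<^sub>1\<close> and
  \<open>q\<^sub>k\<^sub>-\<^sub>1\<gamma> - p\<^sub>k\<^sub>-\<^sub>1\<close>.\<close>

fun cf_denom :: "(nat \<Rightarrow> int) \<Rightarrow> nat \<Rightarrow> int" where
  "cf_denom b 0 = 0"
| "cf_denom b (Suc 0) = 1"
| "cf_denom b (Suc (Suc k)) = b k * cf_denom b (Suc k) + cf_denom b k"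

primrec cf_error :: "(nat \<Rightarrow> real) \<Rightarrow> nat \<Rightarrow> real" where
  "cf_error \<theta> 0 = - 1"
| "cf_error \<theta> (Suc k) = - \<theta> k * cf_error \<theta> k"

text \<open>The head is the digit at position \<open>i\<close>, and its weight is
  \<open>S (Suc i)\<close> because \<open>cf_denom b (Suc i)\<close> is \<open>q\<^sub>i\<close>.
  The ring is generic so that the same digits can be weighted by denominators and by errors.\<close>

primrec digit_sum :: "(nat \<Rightarrow> 'a::comm_ring_1) \<Rightarrow> nat \<Rightarrow> int list \<Rightarrow> 'a" where
  "digit_sum S i [] = 0"
| "digit_sum S i (d # ds) = of_int d * S (Suc i) + digit_sum S (Suc i) ds"

lemma digit_sum_append:
  "digit_sum S i (ds @ es) = digit_sum S i ds + digit_sum S (i + length ds) es"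
  by (induction ds arbitrary: i) (simp_all add: algebra_simps)

lemma digit_sum_zeros: "digit_sum S i (replicate n 0 @ ds) = digit_sum S (i + n) ds"
  by (induction n arbitrary: i) simp_all

lemma digit_sum_eq_sum:
  "digit_sum S i ds = (\<Sum>j<length ds. of_int (ds ! j) * S (i + j + 1))"
  by (induction ds arbitrary: i) (simp_all add: sum.lessThan_Suc_shift del: sum.lessThan_Suc)

lemma of_int_digit_sum: "of_int (digit_sum S i ds) = digit_sum (\<lambda>k. of_int (S k)) i ds"
  by (induction ds arbitrary: i) simp_all

lemma digit_sum_scale: "digit_sum S i (map (\<lambda>d. c * f d) ds) = of_int c * digit_sum S i (map f ds)"
  by (induction ds arbitrary: i) (simp_all add: algebra_simps)

lemma digit_sum_add:
  "digit_sum S i (map (\<lambda>d. f d + g d) ds) = digit_sum S i (map f ds) + digit_sum S i (map g ds)"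
  by (induction ds arbitrary: i) (simp_all add: algebra_simps)

lemma abs_digit_sum_le:
  fixes S :: "nat \<Rightarrow> real"
  assumes "\<forall>d\<in>set ds. real_of_int \<bar>d\<bar> \<le> M"
  shows "\<bar>digit_sum S i ds\<bar> \<le> M * (\<Sum>j<length ds. \<bar>S (i + j + 1)\<bar>)"
proof -
  have "\<bar>digit_sum S i ds\<bar> \<le> (\<Sum>j<length ds. \<bar>of_int (ds ! j) * S (i + j + 1)\<bar>)"
    unfolding digit_sum_eq_sum by (rule sum_abs)
  also have "\<dots> \<le> (\<Sum>j<length ds. M * \<bar>S (i + j + 1)\<bar>)"
    using assms by (intro sum_mono) (auto simp: abs_mult intro!: mult_right_mono)
  finally show ?thesis by (simp add: sum_distrib_left)
qed

text \<open>If \<open>digit_pair b i ds = (x, y)\<close>, then \<open>digit_sum S i ds = x * S (i + 1) + y * S i\<close> for every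
  solution \<open>S\<close> of the recurrence with coefficients \<open>b\<close>.\<close>

primrec digit_pair :: "(nat \<Rightarrow> int) \<Rightarrow> nat \<Rightarrow> int list \<Rightarrow> int \<times> int" where
  "digit_pair b i [] = (0, 0)"
| "digit_pair b i (d # ds) =
     (let (x, y) = digit_pair b (Suc i) ds in (d + b i * x + y, x))"

text \<open>\<open>\<theta>_step\<close> is the Gauss map relation. Periodicity is imposed on
  \<open>b\<close>; its effect on the errors is derived in \<open>\<Delta>_shift\<close>.\<close>

locale periodic_cf =
  fixes b :: "nat \<Rightarrow> int" and P :: nat and \<theta> :: "nat \<Rightarrow> real"
  assumes b_pos: "b k \<ge> 1"
    and P_pos: "P \<ge> 1"
    and b_period: "b (k + P) = b k"
    and \<theta>_pos: "0 < \<theta> k" and \<theta>_less: "\<theta> k < 1"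
    and \<theta>_step: "\<theta> k * (of_int (b k) + \<theta> (Suc k)) = 1"
begin

abbreviation Q :: "nat \<Rightarrow> int" where "Q \<equiv> cf_denom b"
abbreviation \<Delta> :: "nat \<Rightarrow> real" where "\<Delta> \<equiv> cf_error \<theta>"

definition solution :: "(nat \<Rightarrow> 'a::comm_ring_1) \<Rightarrow> bool" where
  "solution S \<longleftrightarrow> (\<forall>k. S (Suc (Suc k)) = of_int (b k) * S (Suc k) + S k)"

lemma solution_Q: "solution Q"
  by (simp add: solution_def)

lemma solution_of_int_Q: "solution (\<lambda>k. of_int (Q k))"
  by (simp add: solution_def)

lemma solution_\<Delta>: "solution \<Delta>"
  unfolding solution_def
proof
  fix k
  have "\<theta> k * \<theta> (Suc k) = 1 - of_int (b k) * \<theta> k" using \<theta>_step[of k] by (simp add: algebra_simps)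
  then have "\<theta> k * \<theta> (Suc k) * \<Delta> k = (1 - of_int (b k) * \<theta> k) * \<Delta> k" by simp
  then show "\<Delta> (Suc (Suc k)) = of_int (b k) * \<Delta> (Suc k) + \<Delta> k" by (simp add: algebra_simps)
qed

lemma solution_eqI:
  assumes "solution S" "solution T" "S 0 = T 0" "S 1 = T 1"
  shows "S k = T k"
proof -
  have "S k = T k \<and> S (Suc k) = T (Suc k)"
    by (induction k) (use assms in \<open>auto simp: solution_def\<close>)
  then show ?thesis ..
qed

lemma solution_shift: "solution S \<Longrightarrow> solution (\<lambda>k. S (k + P))"
  unfolding solution_def using b_period by (metis add_Suc)

lemma digit_sum_pair:
  assumes "solution S" "digit_pair b i ds = (x, y)"
  shows "digit_sum S i ds = of_int x * S (Suc i) + of_int y * S i"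
  using assms(2)
proof (induction ds arbitrary: i x y)
  case (Cons d ds)
  obtain x' y' where *: "digit_pair b (Suc i) ds = (x', y')" by fastforce
  then show ?case
    using Cons.IH[OF *] Cons.prems assms(1) by (auto simp: solution_def algebra_simps)
qed simp

lemma digit_pair_shift: "digit_pair b (i + P) ds = digit_pair b i ds"
proof (induction ds arbitrary: i)
  case (Cons d ds)
  then show ?case using Cons.IH[of "Suc i"] b_period by simp
qed simp

text \<open>Lets a state remember the position of a suffix modulo \<open>P\<close> only.\<close>

lemma digit_pair_mod: "digit_pair b (i mod P) ds = digit_pair b i ds"
proof -
  have "digit_pair b (r + n * P) ds = digit_pair b r ds" for r n
    by (induction n) (use digit_pair_shift[of "r + n * P" for n] in \<open>simp_all add: ac_simps\<close>)
  from this[of "i mod P" "i div P"] show ?thesis by simp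
qed

lemma Q_nonneg: "Q k \<ge> 0" and Q_Suc_pos: "Q (Suc k) \<ge> 1"
proof -
  have "Q k \<ge> 0 \<and> Q (Suc k) \<ge> 1"
  proof (induction k)
    case (Suc k)
    then have "b k * Q (Suc k) \<ge> 1 * 1" using b_pos[of k] by (intro mult_mono) auto
    then show ?case using Suc by simp
  qed simp
  then show "Q k \<ge> 0" "Q (Suc k) \<ge> 1" by auto
qed

lemma Q_add_le: "Q (Suc k) + Q k \<le> Q (Suc (Suc k))"
  using mult_right_mono[OF b_pos, of "Q (Suc k)" k] Q_nonneg[of "Suc k"] by simp

lemma Q_le_Suc: "Q k \<le> Q (Suc k)"
  by (cases k) (use Q_add_le Q_nonneg in \<open>auto simp del: cf_denom.simps(3) intro: order_trans[rotated]\<close>, smt)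

lemma sum_Q_le: "(\<Sum>j<n. Q (i + j + 1)) \<le> 2 * Q (i + n + 1)"
proof -
  \<comment> \<open>This sharper bound is inductive: by \<open>Q_add_le\<close> its right side grows
    by at least the next summand.\<close>
  have "(\<Sum>j<n. Q (i + j + 1)) \<le> Q (i + n + 1) + Q (i + n)"
  proof (induction n)
    case 0 then show ?case using Q_nonneg by simp
  next
    case (Suc n)
    then show ?case using Q_add_le[of "i + n"] by (simp del: cf_denom.simps(3))
  qed
  then show ?thesis using Q_le_Suc[of "i + n"] by simp
qed

lemma abs_\<Delta>_Suc: "\<bar>\<Delta> (Suc k)\<bar> = \<theta> k * \<bar>\<Delta> k\<bar>"
  using \<theta>_pos[of k] by (simp add: abs_mult)

lemma \<Delta>_nonzero: "\<Delta> k \<noteq> 0"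
  by (induction k) (use \<theta>_pos in \<open>auto simp: less_imp_neq[symmetric]\<close>)

lemma abs_\<Delta>_Suc_le: "\<bar>\<Delta> (Suc k)\<bar> \<le> \<bar>\<Delta> k\<bar>"
  unfolding abs_\<Delta>_Suc using \<theta>_less[of k] \<theta>_pos[of k] by (intro mult_left_le_one_le) auto

lemma abs_\<Delta>_antimono: "i \<le> j \<Longrightarrow> \<bar>\<Delta> j\<bar> \<le> \<bar>\<Delta> i\<bar>"
  by (rule lift_Suc_antimono_le[of "\<lambda>k. \<bar>\<Delta> k\<bar>"]) (rule abs_\<Delta>_Suc_le)

lemma abs_\<Delta>_le_1: "\<bar>\<Delta> k\<bar> \<le> 1"
  using abs_\<Delta>_antimono[of 0 k] by simp

text \<open>This is \<open>\<theta>_step\<close> with \<open>b k\<close> lowered to 1, multiplied by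
  \<open>\<bar>\<Delta> k\<bar>\<close>.\<close>

lemma abs_\<Delta>_add_le: "\<bar>\<Delta> (Suc (Suc k))\<bar> + \<bar>\<Delta> (Suc k)\<bar> \<le> \<bar>\<Delta> k\<bar>"
proof -
  have "\<theta> k * (1 + \<theta> (Suc k)) \<le> \<theta> k * (of_int (b k) + \<theta> (Suc k))"
    using \<theta>_pos[of k] b_pos[of k] by (intro mult_left_mono) auto
  then have "\<theta> k * (1 + \<theta> (Suc k)) * \<bar>\<Delta> k\<bar> \<le> 1 * \<bar>\<Delta> k\<bar>"
    unfolding \<theta>_step by (intro mult_right_mono) auto
  then show ?thesis unfolding abs_\<Delta>_Suc by (simp add: algebra_simps)
qed

lemma sum_\<Delta>_le: "(\<Sum>j<n. \<bar>\<Delta> (i + j + 1)\<bar>) \<le> 2 * \<bar>\<Delta> i\<bar>"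
proof -
  \<comment> \<open>With the two boundary terms added, the left side does not increase with
    \<open>n\<close>.\<close>
  have "(\<Sum>j<n. \<bar>\<Delta> (i + j + 1)\<bar>) + \<bar>\<Delta> (i + n)\<bar> + \<bar>\<Delta> (i + n + 1)\<bar> \<le> \<bar>\<Delta> i\<bar> + \<bar>\<Delta> (i + 1)\<bar>"
  proof (induction n)
    case (Suc n)
    then show ?case using abs_\<Delta>_add_le[of "i + n"] by (simp del: cf_error.simps)
  qed simp
  then show ?thesis using abs_\<Delta>_Suc_le[of i] by (simp del: cf_error.simps)
qed

text \<open>Both sides solve the recurrence and agree at 0 and 1, where
  \<open>\<Delta> 0 = - 1\<close> and \<open>\<Delta> 1 = \<theta> 0\<close>. A shift by one period
  thus replaces multiplication by an irrational number, up to a multiple of the error.\<close>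

lemma Q_shift: "of_int (Q (k + P)) = (of_int (Q (Suc P)) + of_int (Q P) * \<theta> 0) * of_int (Q k) - of_int (Q P) * \<Delta> k"
  (is "_ = ?T k")
proof (rule solution_eqI[of "\<lambda>k. real_of_int (Q (k + P))" ?T])
  show "solution (\<lambda>k. real_of_int (Q (k + P)))" using solution_shift[OF solution_of_int_Q] .
  show "solution ?T"
    using solution_\<Delta> solution_of_int_Q[where 'a = real] by (simp add: solution_def algebra_simps del: cf_denom.simps cf_error.simps)
qed auto

end

text \<open>The two forms have determinant \<open>1 + \<rho> * \<theta>\<close>, which is at least 1
  because the coefficients of \<open>x\<close> have opposite signs. Eliminating \<open>y\<close>
  bounds \<open>x\<close>, and the second form then bounds \<open>y\<close>.\<close>

lemma abs_le_of_two_forms: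
  fixes x y \<rho> \<theta> K :: real
  assumes "0 \<le> \<rho>" "\<rho> \<le> 1" "0 \<le> \<theta>" "\<theta> \<le> 1"
    and 1: "\<bar>x + y * \<rho>\<bar> \<le> K" and 2: "\<bar>y - \<theta> * x\<bar> \<le> K"
  shows "\<bar>x\<bar> \<le> 3 * K" "\<bar>y\<bar> \<le> 3 * K"
proof -
  have "x * (1 + \<rho> * \<theta>) = (x + y * \<rho>) - \<rho> * (y - \<theta> * x)" by (simp add: algebra_simps)
  also have "\<bar>\<dots>\<bar> \<le> \<bar>x + y * \<rho>\<bar> + \<rho> * \<bar>y - \<theta> * x\<bar>"
    using assms(1) by (simp add: abs_mult order_trans[OF abs_triangle_ineq4])
  also have "\<dots> \<le> K + 1 * K" using assms by (intro add_mono mult_mono) auto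
  finally have "\<bar>x\<bar> * (1 + \<rho> * \<theta>) \<le> 2 * K" using assms by (simp add: abs_mult)
  moreover have "\<bar>x\<bar> * 1 \<le> \<bar>x\<bar> * (1 + \<rho> * \<theta>)" using assms by (intro mult_left_mono) auto
  ultimately have x: "\<bar>x\<bar> \<le> 2 * K" by simp
  have "\<bar>\<theta> * x\<bar> \<le> 1 * (2 * K)" unfolding abs_mult using assms x by (intro mult_mono) auto
  then show "\<bar>y\<bar> \<le> 3 * K" using 2 by linarith
  show "\<bar>x\<bar> \<le> 3 * K" using x 1 by linarith
qed

section \<open>Scaling of the errors over a period, and boxes for the integer coefficients\<close>

context periodic_cf
begin

text \<open>Linear growth is enough to show in \<open>\<Delta>_shift\<close> that a nonzero multiple
  of \<open>Q\<close> is unbounded.\<close>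

lemma Q_ge: "Q k \<ge> int k - 1"
proof -
  have "Q (Suc k) \<ge> int k" for k
  proof (induction k)
    case (Suc k)
    then show ?case
      using Q_add_le[of k] Q_Suc_pos[of "Suc k"] Q_Suc_pos[of "k - 1"] by (cases k) (auto simp del: cf_denom.simps(3))
  qed simp
  from this[of "k - 1"] show ?thesis using Q_nonneg by (cases k) auto
qed

text \<open>The difference \<open>E\<close> of the two sides solves the recurrence and vanishes at
  0, so it is a multiple of \<open>Q\<close>. It is also bounded, hence zero.\<close>

lemma \<Delta>_shift: "\<Delta> (k + P) = - \<Delta> P * \<Delta> k"
proof -
  define E where "E k = \<Delta> (k + P) + \<Delta> P * \<Delta> k" for k
  define e where "e = E 1"
  have eq: "E k = e * of_int (Q k)" for k
  proof (rule solution_eqI)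
    show "solution E"
      using solution_\<Delta> solution_shift[OF solution_\<Delta>]
      by (simp add: solution_def E_def algebra_simps del: cf_error.simps)
    show "solution (\<lambda>k. e * of_int (Q k))"
      using solution_of_int_Q[where 'a = real] by (simp add: solution_def algebra_simps del: cf_denom.simps)
  qed (auto simp: e_def E_def)
  have "\<bar>E k\<bar> \<le> 2" for k
  proof -
    have "\<bar>\<Delta> P * \<Delta> k\<bar> \<le> 1 * 1" unfolding abs_mult using abs_\<Delta>_le_1 by (intro mult_mono) auto
    then show ?thesis using abs_\<Delta>_le_1[of "k + P"] unfolding E_def by linarith
  qed
  then have bd: "\<bar>e\<bar> * of_int (Q k) \<le> 2" for k
    using eq[of k] Q_nonneg[of k] by (metis abs_mult abs_of_nonneg of_int_0_le_iff)
  have "e = 0"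
  proof (rule ccontr)
    assume "e \<noteq> 0"
    then obtain n :: nat where n: "real n * \<bar>e\<bar> > 2"
      using reals_Archimedean3 by (metis zero_less_abs_iff)
    have "real n \<le> of_int (Q (Suc n))"
      using Q_ge[of "Suc n"] by (simp del: cf_denom.simps)
    then have "real n * \<bar>e\<bar> \<le> of_int (Q (Suc n)) * \<bar>e\<bar>" by (intro mult_right_mono) auto
    then show False using bd[of "Suc n"] n by (simp add: mult.commute)
  qed
  then show ?thesis using eq[of k] by (simp add: E_def)
qed

text \<open>One period multiplies the errors by \<open>- \<Delta> P\<close>, which may be negative.
  Two periods multiply them by a square, so the sign of a combination of errors depends on the
  position modulo \<open>2 * P\<close>.\<close>

lemma \<Delta>_mod:
  obtains c where "c > 0" "\<And>k. \<Delta> (i + k) = c * \<Delta> (i mod (2 * P) + k)"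
proof -
  have step: "\<Delta> (k + 2 * P) = (\<Delta> P)\<^sup>2 * \<Delta> k" for k
    using \<Delta>_shift[of k] \<Delta>_shift[of "k + P"] by (simp add: power2_eq_square mult_2 add.assoc)
  have "\<Delta> (k + n * (2 * P)) = ((\<Delta> P)\<^sup>2) ^ n * \<Delta> k" for n k
  proof (induction n)
    case (Suc n)
    then show ?case using step[of "k + n * (2 * P)"] by (simp add: algebra_simps)
  qed simp
  from this[of "i mod (2 * P) + k" "i div (2 * P)" for k]
  have "\<Delta> (i + k) = ((\<Delta> P)\<^sup>2) ^ (i div (2 * P)) * \<Delta> (i mod (2 * P) + k)" for k
    by (metis add.assoc add.commute mod_div_decomp)
  moreover have "((\<Delta> P)\<^sup>2) ^ (i div (2 * P)) > 0" using \<Delta>_nonzero[of P] by simp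
  ultimately show thesis using that by blast
qed

lemma abs_digit_sum_Q_le:
  assumes "\<forall>d\<in>set ds. real_of_int \<bar>d\<bar> \<le> M" "M \<ge> 0"
  shows "\<bar>digit_sum (\<lambda>k. real_of_int (Q k)) i ds\<bar> \<le> 2 * M * Q (Suc (i + length ds))"
proof -
  have "(\<Sum>j<length ds. \<bar>real_of_int (Q (i + j + 1))\<bar>) = of_int (\<Sum>j<length ds. Q (i + j + 1))"
    using Q_nonneg by (simp del: cf_denom.simps)
  also have "\<dots> \<le> of_int (2 * Q (i + length ds + 1))" by (subst of_int_le_iff) (rule sum_Q_le)
  finally have "M * (\<Sum>j<length ds. \<bar>real_of_int (Q (i + j + 1))\<bar>) \<le> M * of_int (2 * Q (i + length ds + 1))"
    using assms(2) by (intro mult_left_mono)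
  with abs_digit_sum_le[OF assms(1), of "\<lambda>k. real_of_int (Q k)" i] show ?thesis
    by (simp add: algebra_simps del: cf_denom.simps)
qed

lemma abs_digit_sum_\<Delta>_le:
  assumes "\<forall>d\<in>set ds. real_of_int \<bar>d\<bar> \<le> M" "M \<ge> 0"
  shows "\<bar>digit_sum \<Delta> i ds\<bar> \<le> 2 * M * \<bar>\<Delta> i\<bar>"
  using abs_digit_sum_le[OF assms(1), of \<Delta> i] mult_left_mono[OF sum_\<Delta>_le assms(2), of i "length ds"]
  by (simp add: algebra_simps del: cf_error.simps)

definition box :: "real \<Rightarrow> (int \<times> int) set" where
  "box K = {-\<lceil>3 * K\<rceil>..\<lceil>3 * K\<rceil>} \<times> {-\<lceil>3 * K\<rceil>..\<lceil>3 * K\<rceil>}"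

lemma finite_box: "finite (box K)"
  by (simp add: box_def)

text \<open>Dividing the first form by \<open>Q (Suc i)\<close> and the second by
  \<open>\<Delta> i\<close> gives the forms of \<open>abs_le_of_two_forms\<close> with
  \<open>\<rho> = Q i / Q (Suc i)\<close> and \<open>\<theta> i\<close>; the factor 3 in
  \<open>box\<close> comes from there.\<close>

lemma in_boxI:
  assumes 1: "\<bar>of_int x * of_int (Q (Suc i)) + of_int y * of_int (Q i)\<bar> \<le> K * of_int (Q (Suc i))"
    and 2: "\<bar>of_int x * \<Delta> (Suc i) + of_int y * \<Delta> i\<bar> \<le> K * \<bar>\<Delta> i\<bar>"
  shows "(x, y) \<in> box K"
proof -
  define q where "q = real_of_int (Q (Suc i))"
  define \<rho> where "\<rho> = of_int (Q i) / q"
  have q: "q > 0" using Q_Suc_pos[of i] by (simp add: q_def)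
  have \<rho>: "0 \<le> \<rho>" "\<rho> \<le> 1" "\<rho> * q = of_int (Q i)"
    using q Q_nonneg[of i] Q_le_Suc[of i] by (auto simp: \<rho>_def q_def divide_le_eq)
  have "(of_int x + of_int y * \<rho>) * q = of_int x * q + of_int y * of_int (Q i)"
    unfolding \<rho>(3)[symmetric] by (simp add: algebra_simps)
  then have "\<bar>(of_int x + of_int y * \<rho>) * q\<bar> \<le> K * q"
    using 1 by (simp add: q_def)
  then have 3: "\<bar>of_int x + of_int y * \<rho>\<bar> \<le> K" using q by (simp add: abs_mult)
  have "\<bar>(of_int y - \<theta> i * of_int x) * \<Delta> i\<bar> \<le> K * \<bar>\<Delta> i\<bar>"
    using 2 by (simp add: algebra_simps)
  then have 4: "\<bar>of_int y - \<theta> i * of_int x\<bar> \<le> K" using \<Delta>_nonzero[of i] by (simp add: abs_mult)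
  have "\<bar>real_of_int x\<bar> \<le> 3 * K" "\<bar>real_of_int y\<bar> \<le> 3 * K"
    using abs_le_of_two_forms[OF \<rho>(1,2) _ _ 3 4] \<theta>_pos[of i] \<theta>_less[of i] by auto
  then have "x \<le> \<lceil>3 * K\<rceil>" "- \<lceil>3 * K\<rceil> \<le> x" "y \<le> \<lceil>3 * K\<rceil>" "- \<lceil>3 * K\<rceil> \<le> y"
    by linarith+
  then show ?thesis by (simp add: box_def)
qed

section \<open>Finite index of the integral equation and of the sign condition on errors\<close>

lemma finite_digit_bound:
  assumes "finite \<Sigma>"
  obtains M where "M \<ge> 0" "\<And>u. u \<in> lists \<Sigma> \<Longrightarrow> \<forall>d\<in>set (map f u). real_of_int \<bar>d\<bar> \<le> M"
proof
  show "(\<Sum>l\<in>\<Sigma>. real_of_int \<bar>f l\<bar>) \<ge> 0" by (simp add: sum_nonneg)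
  fix u assume "u \<in> lists \<Sigma>"
  then have "\<bar>f l\<bar> \<le> (\<Sum>l\<in>\<Sigma>. \<bar>f l\<bar>)" if "l \<in> set u" for l
    using that assms by (intro member_le_sum) auto
  then show "\<forall>d\<in>set (map f u). real_of_int \<bar>d\<bar> \<le> (\<Sum>l\<in>\<Sigma>. real_of_int \<bar>f l\<bar>)"
    by (auto simp flip: of_int_sum of_int_abs)
qed

text \<open>The value of a prefix is unbounded, so it cannot be the state. What matters is which
  suffix pairs \<open>(x, y)\<close> bring the total to \<open>m\<close>; these lie in a fixed
  finite box.\<close>

lemma finite_index_Q_sum_eq:
  fixes f h :: "'l \<Rightarrow> int"
  assumes fin: "finite \<Sigma>"
  shows "finite_index \<Sigma> (\<lambda>u. digit_sum Q 0 (map f u) + digit_sum Q P (map h u) = m)"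
proof -
  obtain M1 where M1: "M1 \<ge> 0" "\<And>u. u \<in> lists \<Sigma> \<Longrightarrow> \<forall>d\<in>set (map f u). real_of_int \<bar>d\<bar> \<le> M1"
    using finite_digit_bound[OF fin] by blast
  obtain M2 where M2: "M2 \<ge> 0" "\<And>u. u \<in> lists \<Sigma> \<Longrightarrow> \<forall>d\<in>set (map h u). real_of_int \<bar>d\<bar> \<le> M2"
    using finite_digit_bound[OF fin] by blast
  \<comment> \<open>Prepending \<open>P\<close> zeros moves the shifted sum back to position
    \<open>i\<close>, so both sums are expressed through the same two terms of the
    recurrence.\<close>
  define pair where "pair i z =
    (fst (digit_pair b i (map f z)) + fst (digit_pair b i (replicate P 0 @ map h z)),
     snd (digit_pair b i (map f z)) + snd (digit_pair b i (replicate P 0 @ map h z)))" for i and z :: "'l list"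
  have pair: "digit_sum S i (map f z) + digit_sum S (i + P) (map h z) = of_int x * S (Suc i) + of_int y * S i"
    if "solution S" "pair i z = (x, y)" for S :: "nat \<Rightarrow> 'b::comm_ring_1" and i z x y
    using digit_sum_pair[OF that(1) surjective_pairing, of i "map f z"]
      digit_sum_pair[OF that(1) surjective_pairing, of i "replicate P 0 @ map h z"] that(2)
    unfolding digit_sum_zeros by (auto simp: pair_def algebra_simps simp del: digit_pair.simps)
  have pair_mod: "pair (i mod P) z = pair i z" for i z
    by (simp add: pair_def digit_pair_mod)
  define val where "val u = digit_sum Q 0 (map f u) + digit_sum Q P (map h u)" for u
  have val_append: "val (u @ z) = val u + x * Q (Suc i) + y * Q i"
    if "pair i z = (x, y)" "i = length u" for u z i x y
    using pair[OF solution_Q that(1)] that(2)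
    by (simp add: val_def digit_sum_append add.commute del: cf_denom.simps)
  \<comment> \<open>\<open>C\<close> bounds the growth of \<open>Q\<close> over one period. It comes
    from \<open>Q_shift\<close>, using \<open>\<theta> 0 < 1\<close> and
    \<open>\<bar>\<Delta> k\<bar> \<le> 1\<close>.\<close>
  define C where "C = of_int (Q (Suc P)) + 2 * real_of_int (Q P)"
  have C: "of_int (Q (Suc k + P)) \<le> C * of_int (Q (Suc k))" for k
  proof -
    have "- of_int (Q P) * \<Delta> (Suc k) \<le> of_int (Q P) * 1"
      using abs_\<Delta>_le_1[of "Suc k"] Q_nonneg[of P] mult_left_mono[of "- \<Delta> (Suc k)" 1 "real_of_int (Q P)"] by simp
    also have "\<dots> \<le> of_int (Q P) * of_int (Q (Suc k))"
      using Q_nonneg[of P] Q_Suc_pos[of k] by (intro mult_left_mono) auto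
    finally have 1: "- of_int (Q P) * \<Delta> (Suc k) \<le> of_int (Q P) * of_int (Q (Suc k))" .
    have "of_int (Q P) * \<theta> 0 \<le> of_int (Q P) * 1"
      using Q_nonneg[of P] \<theta>_less[of 0] by (intro mult_left_mono) auto
    then have "(of_int (Q P) * \<theta> 0) * of_int (Q (Suc k)) \<le> of_int (Q P) * of_int (Q (Suc k))"
      using Q_Suc_pos[of k] by (intro mult_right_mono) auto
    with 1 show ?thesis unfolding Q_shift[of "Suc k"] C_def
      by (simp add: algebra_simps del: cf_denom.simps cf_error.simps)
  qed
  define K where "K = 2 * M1 + 2 * M2 * C + \<bar>of_int m\<bar> + 2 * M2"
  have C0: "C \<ge> 0" using Q_nonneg by (simp add: C_def)
  \<comment> \<open>For \<open>Q\<close> the pair yields \<open>m\<close> minus the value of the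
    prefix, which is controlled by the digits read. For \<open>\<Delta>\<close> the same pair yields
    the weighted suffix, which is controlled by \<open>sum_\<Delta>_le\<close>.\<close>
  have in_box: "(x, y) \<in> box K"
    if u: "u \<in> lists \<Sigma>" and z: "z \<in> lists \<Sigma>" and p: "pair (length u) z = (x, y)" and eq: "val (u @ z) = m"
    for u z x y
  proof (rule in_boxI)
    let ?i = "length u"
    let ?q = "real_of_int (Q (Suc ?i))"
    have q: "?q \<ge> 1" using Q_Suc_pos[of ?i] by simp
    have "\<bar>digit_sum (\<lambda>k. real_of_int (Q k)) 0 (map f u)\<bar> \<le> 2 * M1 * ?q"
      using abs_digit_sum_Q_le[OF M1(2)[OF u] M1(1), of 0] by simp
    moreover have "\<bar>digit_sum (\<lambda>k. real_of_int (Q k)) P (map h u)\<bar> \<le> 2 * M2 * Q (Suc ?i + P)"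
      using abs_digit_sum_Q_le[OF M2(2)[OF u] M2(1), of P] by (simp add: add.commute del: cf_denom.simps)
    moreover have "2 * M2 * Q (Suc ?i + P) \<le> 2 * M2 * (C * ?q)"
      using C[of ?i] M2(1) by (intro mult_left_mono) auto
    ultimately have "\<bar>real_of_int (val u)\<bar> \<le> 2 * M1 * ?q + 2 * M2 * (C * ?q)"
      unfolding val_def of_int_add of_int_digit_sum by linarith
    moreover have "\<bar>real_of_int m\<bar> \<le> \<bar>of_int m\<bar> * ?q" using q by (simp add: mult_le_cancel_left1)
    moreover have "of_int x * ?q + of_int y * of_int (Q ?i) = of_int m - real_of_int (val u)"
      using val_append[OF p refl] eq by (simp flip: of_int_mult of_int_add of_int_diff)
    moreover have "0 \<le> 2 * M2 * ?q" using M2(1) q by simp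
    ultimately show "\<bar>of_int x * ?q + of_int y * of_int (Q ?i)\<bar> \<le> K * ?q"
      unfolding K_def by (simp add: algebra_simps)
  next
    let ?i = "length u"
    have "\<bar>digit_sum \<Delta> ?i (map f z)\<bar> \<le> 2 * M1 * \<bar>\<Delta> ?i\<bar>"
      using abs_digit_sum_\<Delta>_le[OF M1(2)[OF z] M1(1)] .
    moreover have "\<bar>digit_sum \<Delta> (?i + P) (map h z)\<bar> \<le> 2 * M2 * \<bar>\<Delta> (?i + P)\<bar>"
      using abs_digit_sum_\<Delta>_le[OF M2(2)[OF z] M2(1)] .
    moreover have "2 * M2 * \<bar>\<Delta> (?i + P)\<bar> \<le> 2 * M2 * \<bar>\<Delta> ?i\<bar>"
      using abs_\<Delta>_antimono[of ?i "?i + P"] M2(1) by (intro mult_left_mono) auto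
    moreover have "0 \<le> (2 * M2 * C + \<bar>of_int m\<bar>) * \<bar>\<Delta> ?i\<bar>" using M2(1) C0 by simp
    ultimately show "\<bar>of_int x * \<Delta> (Suc ?i) + of_int y * \<Delta> ?i\<bar> \<le> K * \<bar>\<Delta> ?i\<bar>"
      unfolding pair[OF solution_\<Delta> p, symmetric] K_def distrib_right by linarith
  qed
  define g where "g u = (length u mod P, {(x, y) \<in> box K. val u + x * Q (Suc (length u)) + y * Q (length u) = m})" for u
  have "finite_index \<Sigma> (\<lambda>u. val u = m)"
  proof (rule finite_index_factor[where g = g])
    have "g ` lists \<Sigma> \<subseteq> {..<P} \<times> Pow (box K)" using P_pos by (auto simp: g_def)
    then show "finite (g ` lists \<Sigma>)" by (rule finite_subset) (simp add: finite_box)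
  next
    fix u u' z assume *: "u \<in> lists \<Sigma>" "u' \<in> lists \<Sigma>" "z \<in> lists \<Sigma>" "g u = g u'" "val (u @ z) = m"
    obtain x y where p: "pair (length u) z = (x, y)" by fastforce
    have p': "pair (length u') z = (x, y)"
      using *(4) p pair_mod[of "length u" z] pair_mod[of "length u'" z] by (simp add: g_def)
    have "(x, y) \<in> snd (g u)"
      using in_box[OF *(1,3) p *(5)] val_append[OF p refl] *(5) by (simp add: g_def del: cf_denom.simps)
    then have "(x, y) \<in> snd (g u')" using *(4) by simp
    then show "val (u' @ z) = m" using val_append[OF p' refl] by (simp add: g_def del: cf_denom.simps)
  qed
  then show ?thesis unfolding val_def .
qed

text \<open>Here a prefix is expressed at its end, by solving the recurrence for its oldest term.
  One pair serves all solutions \<open>S\<close>, so \<open>Q\<close> and \<open>\<Delta>\<close>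
  can bound it together. The terms with \<open>r\<close> and \<open>s\<close> carry the additive
  constants.\<close>

lemma digit_sum_top_pair:
  obtains x y :: int where
    "\<And>S :: nat \<Rightarrow> real. solution S \<Longrightarrow> digit_sum S 0 ds + of_int r * S 0 + of_int s * S 1 =
       of_int x * S (Suc (length ds)) + of_int y * S (length ds)"
proof -
  have "\<exists>x y :: int. \<forall>S :: nat \<Rightarrow> real. solution S \<longrightarrow> digit_sum S 0 ds + of_int r * S 0 + of_int s * S 1 =
       of_int x * S (Suc (length ds)) + of_int y * S (length ds)"
  proof (induction ds rule: rev_induct)
    case Nil
    show ?case by (intro exI[of _ s] exI[of _ r]) simp
  next
    case (snoc d ds)
    then obtain x y :: int where IH: "\<And>S :: nat \<Rightarrow> real. solution S \<Longrightarrow>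
       digit_sum S 0 ds + of_int r * S 0 + of_int s * S 1 =
       of_int x * S (Suc (length ds)) + of_int y * S (length ds)" by blast
    show ?case
    proof (intro exI allI impI)
      fix S :: "nat \<Rightarrow> real" assume S: "solution S"
      have "S (Suc (Suc (length ds))) = of_int (b (length ds)) * S (Suc (length ds)) + S (length ds)"
        using S by (simp add: solution_def)
      then show "digit_sum S 0 (ds @ [d]) + of_int r * S 0 + of_int s * S 1 =
        of_int y * S (Suc (length (ds @ [d]))) + of_int (x + d - b (length ds) * y) * S (length (ds @ [d]))"
        using IH[OF S] by (simp add: digit_sum_append algebra_simps)
    qed
  qed
  then show thesis using that by blast
qed

text \<open>A suffix changes the value by at most \<open>2 * M * \<bar>\<Delta> i\<bar>\<close>. A
  prefix value beyond this has its final sign already; a smaller one is given by a pair in a finite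
  box.\<close>

lemma finite_index_\<Delta>_sum_nonneg:
  fixes h :: "'l \<Rightarrow> int"
  assumes fin: "finite \<Sigma>"
  shows "finite_index \<Sigma> (\<lambda>u. digit_sum \<Delta> 0 (map h u) + of_int r * \<Delta> 0 + of_int s * \<Delta> 1 \<ge> 0)"
proof -
  obtain M where M: "M \<ge> 0" "\<And>u. u \<in> lists \<Sigma> \<Longrightarrow> \<forall>d\<in>set (map h u). real_of_int \<bar>d\<bar> \<le> M"
    using finite_digit_bound[OF fin] by blast
  define val where "val u = digit_sum \<Delta> 0 (map h u) + of_int r * \<Delta> 0 + of_int s * \<Delta> 1" for u
  define K where "K = 2 * M + \<bar>of_int r\<bar> + \<bar>of_int s\<bar>"
  define g where "g u = (length u mod (2 * P),
     {(x, y) \<in> box K. val u = of_int x * \<Delta> (Suc (length u)) + of_int y * \<Delta> (length u)}, val u \<ge> 0)" for u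
  have val_append: "val (u @ z) = val u + digit_sum \<Delta> (length u) (map h z)" for u z
    by (simp add: val_def digit_sum_append)
  have tail: "\<bar>digit_sum \<Delta> i (map h z)\<bar> \<le> 2 * M * \<bar>\<Delta> i\<bar>" if "z \<in> lists \<Sigma>" for i z
    using abs_digit_sum_\<Delta>_le[OF M(2)[OF that] M(1)] .
  have box_pair: "\<exists>x y. (x, y) \<in> fst (snd (g u))"
    if u: "u \<in> lists \<Sigma>" and small: "\<bar>val u\<bar> \<le> 2 * M * \<bar>\<Delta> (length u)\<bar>" for u
  proof -
    let ?i = "length u"
    obtain x y :: int where xy: "\<And>S :: nat \<Rightarrow> real. solution S \<Longrightarrow>
      digit_sum S 0 (map h u) + of_int r * S 0 + of_int s * S 1 = of_int x * S (Suc ?i) + of_int y * S ?i"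
      using digit_sum_top_pair[of "map h u" r s] by (metis length_map)
    have 1: "val u = of_int x * \<Delta> (Suc ?i) + of_int y * \<Delta> ?i"
      unfolding val_def using xy[OF solution_\<Delta>] .
    have "(x, y) \<in> box K"
    proof (rule in_boxI)
      have "\<bar>digit_sum (\<lambda>k. real_of_int (Q k)) 0 (map h u)\<bar> \<le> 2 * M * Q (Suc ?i)"
        using abs_digit_sum_Q_le[OF M(2)[OF u] M(1), of 0] by simp
      moreover have "\<bar>real_of_int s\<bar> \<le> \<bar>of_int s\<bar> * Q (Suc ?i)" "0 \<le> \<bar>real_of_int r\<bar> * Q (Suc ?i)"
        using Q_Suc_pos[of ?i] by (simp_all add: mult_le_cancel_left1)
      ultimately show "\<bar>of_int x * of_int (Q (Suc ?i)) + of_int y * of_int (Q ?i)\<bar> \<le> K * of_int (Q (Suc ?i))"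
        unfolding xy[OF solution_of_int_Q, symmetric] K_def by (simp add: algebra_simps)
      have "0 \<le> (\<bar>of_int r\<bar> + \<bar>of_int s\<bar>) * \<bar>\<Delta> ?i\<bar>" by simp
      then show "\<bar>of_int x * \<Delta> (Suc ?i) + of_int y * \<Delta> ?i\<bar> \<le> K * \<bar>\<Delta> ?i\<bar>"
        using small unfolding 1[symmetric] K_def distrib_right by linarith
    qed
    then show ?thesis using 1 by (auto simp: g_def)
  qed
  have "finite_index \<Sigma> (\<lambda>u. val u \<ge> 0)"
  proof (rule finite_index_factor[where g = g])
    have "g ` lists \<Sigma> \<subseteq> {..<2 * P} \<times> Pow (box K) \<times> UNIV" using P_pos by (auto simp: g_def)
    then show "finite (g ` lists \<Sigma>)" by (rule finite_subset) (simp add: finite_box)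
  next
    fix u u' z
    assume *: "u \<in> lists \<Sigma>" "u' \<in> lists \<Sigma>" "z \<in> lists \<Sigma>" "g u = g u'" "val (u @ z) \<ge> 0"
    show "val (u' @ z) \<ge> 0"
    proof (cases "\<exists>x y. (x, y) \<in> fst (snd (g u))")
      \<comment> \<open>No pair in the box, so both prefix values are too large for the suffix to
        change their signs.\<close>
      case False
      with box_pair *(1,2,4) have "\<bar>val u\<bar> > 2 * M * \<bar>\<Delta> (length u)\<bar>" "\<bar>val u'\<bar> > 2 * M * \<bar>\<Delta> (length u')\<bar>"
        by (metis not_le)+
      moreover have "val u \<ge> 0 \<longleftrightarrow> val u' \<ge> 0" using *(4) by (simp add: g_def)
      ultimately show ?thesis
        using tail[OF *(3), of "length u"] tail[OF *(3), of "length u'"] *(5) unfolding val_append by linarith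
    next
      case True
      then obtain x y where xy: "(x, y) \<in> fst (snd (g u))" by blast
      let ?i = "length u mod (2 * P)"
      obtain x' y' where p: "digit_pair b (?i mod P) (map h z) = (x', y')" by fastforce
      \<comment> \<open>The total is a positive multiple of an expression in \<open>(x, y)\<close>,
        the residue \<open>?i\<close> and \<open>z\<close> alone.\<close>
      have key: "val (v @ z) \<ge> 0 \<longleftrightarrow> of_int (x + x') * \<Delta> (Suc ?i) + of_int (y + y') * \<Delta> ?i \<ge> 0"
        if v: "length v mod (2 * P) = ?i" "(x, y) \<in> fst (snd (g v))" for v
      proof -
        have "length v mod P = ?i mod P" using v(1) by (metis mod_mult_self1 mod_mod_cancel dvd_triv_right)
        then have "digit_pair b (length v) (map h z) = (x', y')"
          using p digit_pair_mod by metis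
        from digit_sum_pair[OF solution_\<Delta> this] v(2)
        have eq: "val (v @ z) = of_int (x + x') * \<Delta> (Suc (length v)) + of_int (y + y') * \<Delta> (length v)"
          unfolding val_append by (simp add: g_def algebra_simps del: cf_error.simps)
        obtain c where c: "c > 0" "\<And>k. \<Delta> (length v + k) = c * \<Delta> (?i + k)"
          using \<Delta>_mod[of "length v"] v(1) by metis
        have "val (v @ z) = c * (of_int (x + x') * \<Delta> (Suc ?i) + of_int (y + y') * \<Delta> ?i)"
          unfolding eq using c(2)[of 0] c(2)[of 1] by (simp add: algebra_simps del: cf_error.simps)
        then show ?thesis using c(1) by (simp add: zero_le_mult_iff)
      qed
      show ?thesis
      proof -
        have mod_eq: "length u' mod (2 * P) = ?i" using *(4) by (simp add: g_def)
        have xy': "(x, y) \<in> fst (snd (g u'))" using xy *(4) by simp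
        show ?thesis using key[OF refl xy] key[OF mod_eq xy'] *(5) by simp
      qed
    qed
  qed
  then show ?thesis unfolding val_def .
qed

end

subsection \<open>Ostrowski representations\<close>

text \<open>Leading zeros are allowed and the length is separate from the digit function, so that
  truncation is only a change of \<open>t\<close>.\<close>

definition ostrowski_digits :: "real \<Rightarrow> (nat \<Rightarrow> nat) \<Rightarrow> nat \<Rightarrow> bool" where
  "ostrowski_digits \<gamma> e t \<longleftrightarrow>
     (\<forall>i. 1 \<le> i \<and> i < t \<longrightarrow> e i \<le> partial_quotient \<gamma> (i + 1)) \<and>
     (\<forall>i. 1 \<le> i \<and> i < t \<and> e i = partial_quotient \<gamma> (i + 1) \<longrightarrow> e (i - 1) = 0) \<and>
     (0 < t \<longrightarrow> e 0 < partial_quotient \<gamma> 1)"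

abbreviation ostrowski_value :: "real \<Rightarrow> (nat \<Rightarrow> nat) \<Rightarrow> nat \<Rightarrow> nat" where
  "ostrowski_value \<gamma> e t \<equiv> \<Sum>i<t. e i * convergent_denom \<gamma> i"

lemma is_ostrowski_rep_iff:
  "is_ostrowski_rep \<gamma> n w \<longleftrightarrow>
     n = ostrowski_value \<gamma> (\<lambda>i. rev w ! i) (length w) \<and>
     ostrowski_digits \<gamma> (\<lambda>i. rev w ! i) (length w) \<and> (w \<noteq> [] \<longrightarrow> hd w \<noteq> 0)"
  unfolding is_ostrowski_rep_def ostrowski_digits_def Let_def conj_assoc ..

lemma ostrowski_digits_mono: "ostrowski_digits \<gamma> e t \<Longrightarrow> s \<le> t \<Longrightarrow> ostrowski_digits \<gamma> e s"
  by (auto simp: ostrowski_digits_def)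

lemma ostrowski_digits_le:
  "ostrowski_digits \<gamma> e t \<Longrightarrow> i < t \<Longrightarrow> e i \<le> partial_quotient \<gamma> (Suc i)"
  by (cases i) (auto simp: ostrowski_digits_def)

lemma ostrowski_digits_cong:
  assumes "\<And>i. i < t \<Longrightarrow> e i = e' i"
  shows "ostrowski_digits \<gamma> e t \<longleftrightarrow> ostrowski_digits \<gamma> e' t"
proof -
  have "e (i - 1) = e' (i - 1)" if "i < t" for i using that assms by simp
  then show ?thesis unfolding ostrowski_digits_def using assms by (metis gr_zeroI)
qed

context
  fixes \<gamma> :: real
  assumes pq_pos: "\<And>i. partial_quotient \<gamma> (Suc i) > 0"
begin

lemma convergent_denom_le_Suc: "convergent_denom \<gamma> i \<le> convergent_denom \<gamma> (Suc i)"
  and convergent_denom_pos: "0 < convergent_denom \<gamma> i"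
proof -
  have step: "m \<le> partial_quotient \<gamma> (Suc i) * m + k" for m k i
    using pq_pos[of i] by (cases "partial_quotient \<gamma> (Suc i)") auto
  have pos: "0 < convergent_denom \<gamma> i" for i
  proof (induction i rule: less_induct)
    case (less i)
    consider "i = 0" | "i = 1" | j where "i = Suc (Suc j)"
      by (metis One_nat_def nat.exhaust)
    then show ?case using less pq_pos[of 0] by cases auto
  qed
  show "0 < convergent_denom \<gamma> i" by (rule pos)
  show "convergent_denom \<gamma> i \<le> convergent_denom \<gamma> (Suc i)"
    using pq_pos[of 0] step by (cases i) auto
qed

lemma convergent_denom_mono: "i \<le> j \<Longrightarrow> convergent_denom \<gamma> i \<le> convergent_denom \<gamma> j"
  by (rule lift_Suc_mono_le) (rule convergent_denom_le_Suc)

text \<open>A maximal top digit forces a zero below it, leaving a value less than the denominator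
  two places down. A smaller top digit leaves room for one whole copy of the previous
  denominator.\<close>

lemma ostrowski_value_less:
  "ostrowski_digits \<gamma> e t \<Longrightarrow> ostrowski_value \<gamma> e t < convergent_denom \<gamma> t"
proof (induction t rule: less_induct)
  case (less t)
  consider "t = 0" | "t = 1" | s where "t = Suc (Suc s)"
    by (metis One_nat_def nat.exhaust)
  then show ?case
  proof cases
    case 2
    then show ?thesis using less.prems by (simp add: ostrowski_digits_def)
  next
    case (3 s)
    let ?a = "partial_quotient \<gamma> (Suc (Suc s))" and ?q = "convergent_denom \<gamma>"
    have le: "e (Suc s) \<le> ?a" using ostrowski_digits_le[OF less.prems, of "Suc s"] 3 by simp
    show ?thesis
    proof (cases "e (Suc s) = ?a")
      case True
      then have "e s = 0" using less.prems unfolding ostrowski_digits_def 3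
        by (metis Suc_eq_plus1 diff_Suc_1 le_add2 lessI)
      then show ?thesis
        using less.IH[of s] ostrowski_digits_mono[OF less.prems, of s] True 3 by simp
    next
      case False
      then have "(e (Suc s) + 1) * ?q (Suc s) \<le> ?a * ?q (Suc s)"
        using le by (intro mult_right_mono) auto
      then show ?thesis
        using less.IH[of "Suc s"] ostrowski_digits_mono[OF less.prems, of "Suc s"] 3 by simp
    qed
  qed simp
qed

text \<open>The lower digits sum to less than \<open>?q\<close>, so the top digit is a quotient by
  \<open>?q\<close>.\<close>

lemma ostrowski_digits_unique:
  assumes "ostrowski_digits \<gamma> e t" "ostrowski_digits \<gamma> e' t"
    and "ostrowski_value \<gamma> e t = ostrowski_value \<gamma> e' t" and "i < t"
  shows "e i = e' i"
  using assms
proof (induction t arbitrary: i)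
  case (Suc t)
  let ?q = "convergent_denom \<gamma> t"
  note d = ostrowski_digits_mono[OF Suc.prems(1), of t] ostrowski_digits_mono[OF Suc.prems(2), of t]
  have lt: "ostrowski_value \<gamma> e t < ?q" "ostrowski_value \<gamma> e' t < ?q"
    using d ostrowski_value_less by auto
  have eq: "ostrowski_value \<gamma> e t + e t * ?q = ostrowski_value \<gamma> e' t + e' t * ?q"
    using Suc.prems(3) by simp
  then have top: "e t = e' t"
  proof -
    have "(ostrowski_value \<gamma> e t + e t * ?q) div ?q = e t"
      "(ostrowski_value \<gamma> e' t + e' t * ?q) div ?q = e' t"
      using lt by (auto simp: div_mult_self1)
    then show ?thesis using eq by simp
  qed
  then show ?case using Suc.IH[OF d] eq Suc.prems(4) by (cases "i = t") auto
qed simp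

text \<open>Greedy division. If the quotient is the maximal digit, the remainder is so small that
  the next digit can be set to 0.\<close>

lemma ostrowski_digits_exist:
  "n < convergent_denom \<gamma> t \<Longrightarrow> \<exists>e. ostrowski_digits \<gamma> e t \<and> ostrowski_value \<gamma> e t = n"
proof (induction t arbitrary: n rule: less_induct)
  case (less t)
  consider "t = 0" | "t = 1" | s where "t = Suc (Suc s)"
    by (metis One_nat_def nat.exhaust)
  then show ?case
  proof cases
    case 1
    then show ?thesis using less.prems by (auto simp: ostrowski_digits_def)
  next
    case 2
    then show ?thesis using less.prems by (intro exI[of _ "\<lambda>_. n"]) (auto simp: ostrowski_digits_def)
  next
    case (3 s)
    let ?a = "partial_quotient \<gamma> (Suc (Suc s))" and ?q = "convergent_denom \<gamma>"
    define d r where "d = n div ?q (Suc s)" and "r = n mod ?q (Suc s)"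
    have n: "n = d * ?q (Suc s) + r" by (simp only: d_def r_def div_mult_mod_eq)
    have r: "r < ?q (Suc s)" using convergent_denom_pos by (simp add: r_def)
    have "n < (?a + 1) * ?q (Suc s)"
      using less.prems 3 convergent_denom_le_Suc[of s] by simp
    then have "d < ?a + 1" unfolding d_def by (rule less_mult_imp_div_less)
    then consider "d < ?a" | "d = ?a" by linarith
    then show ?thesis
    proof cases
      case 1
      obtain e where e: "ostrowski_digits \<gamma> e (Suc s)" "ostrowski_value \<gamma> e (Suc s) = r"
        using less.IH[of "Suc s" r] r 3 by auto
      show ?thesis
      proof (intro exI conjI)
        show "ostrowski_digits \<gamma> (e(Suc s := d)) t"
          using e(1) 1 unfolding ostrowski_digits_def 3 by (auto simp: less_Suc_eq)
        show "ostrowski_value \<gamma> (e(Suc s := d)) t = n"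
          using e(2) n 3 by simp
      qed
    next
      case 2
      then have "r < ?q s" using less.prems n 3 by simp
      then obtain e where e: "ostrowski_digits \<gamma> e s" "ostrowski_value \<gamma> e s = r"
        using less.IH[of s r] 3 by auto
      show ?thesis
      proof (intro exI conjI)
        show "ostrowski_digits \<gamma> (e(s := 0, Suc s := d)) t"
          using e(1) 2 pq_pos[of 0] pq_pos[of s] unfolding ostrowski_digits_def 3
          by (auto simp: less_Suc_eq)
        show "ostrowski_value \<gamma> (e(s := 0, Suc s := d)) t = n"
          using e(2) n 3 by simp
      qed
    qed
  qed
qed

lemma is_ostrowski_rep_length_le:
  assumes "is_ostrowski_rep \<gamma> n w" "n < convergent_denom \<gamma> t"
  shows "length w \<le> t"
proof (rule ccontr)
  assume *: "\<not> length w \<le> t"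
  then obtain s where s: "length w = Suc s" and ts: "t \<le> s" by (cases "length w") auto
  have n: "n = ostrowski_value \<gamma> (\<lambda>i. rev w ! i) (length w)" and hd: "w \<noteq> [] \<longrightarrow> hd w \<noteq> 0"
    using assms(1) unfolding is_ostrowski_rep_iff by blast+
  have "rev w ! s = hd w" using s by (cases w) (auto simp: nth_append)
  moreover have "w \<noteq> []" using s by auto
  ultimately have "rev w ! s > 0" using hd by auto
  then have "1 * convergent_denom \<gamma> s \<le> rev w ! s * convergent_denom \<gamma> s"
    by (intro mult_right_mono) auto
  also have "\<dots> \<le> n" unfolding n s by (simp only: sum.lessThan_Suc le_add2)
  also have "\<dots> < convergent_denom \<gamma> t" by fact
  also have "\<dots> \<le> convergent_denom \<gamma> s" using ts by (rule convergent_denom_mono)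
  finally show False by simp
qed

lemma is_ostrowski_rep_less:
  assumes "is_ostrowski_rep \<gamma> n w"
  shows "n < convergent_denom \<gamma> (length w)"
proof -
  have n: "n = ostrowski_value \<gamma> (\<lambda>i. rev w ! i) (length w)"
    and d: "ostrowski_digits \<gamma> (\<lambda>i. rev w ! i) (length w)"
    using assms unfolding is_ostrowski_rep_iff by blast+
  show ?thesis by (subst n) (rule ostrowski_value_less[OF d])
qed

lemma is_ostrowski_rep_unique:
  assumes "is_ostrowski_rep \<gamma> n w" "is_ostrowski_rep \<gamma> n w'"
  shows "w = w'"
proof -
  have len: "length w = length w'"
    using is_ostrowski_rep_length_le[OF assms(1) is_ostrowski_rep_less[OF assms(2)]]
      is_ostrowski_rep_length_le[OF assms(2) is_ostrowski_rep_less[OF assms(1)]] by (rule antisym)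
  have "rev w ! i = rev w' ! i" if "i < length w" for i
  proof (rule ostrowski_digits_unique[OF _ _ _ that])
    show "ostrowski_digits \<gamma> (\<lambda>i. rev w ! i) (length w)"
      using assms(1) unfolding is_ostrowski_rep_iff by blast
    show "ostrowski_digits \<gamma> (\<lambda>i. rev w' ! i) (length w)"
      using assms(2) unfolding is_ostrowski_rep_iff len by blast
    have "n = ostrowski_value \<gamma> (\<lambda>i. rev w ! i) (length w)"
      using assms(1) unfolding is_ostrowski_rep_iff by blast
    moreover have "n = ostrowski_value \<gamma> (\<lambda>i. rev w' ! i) (length w)"
      using assms(2) unfolding is_ostrowski_rep_iff len by blast
    ultimately show "ostrowski_value \<gamma> (\<lambda>i. rev w ! i) (length w) = ostrowski_value \<gamma> (\<lambda>i. rev w' ! i) (length w)"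
      by (rule subst)
  qed
  then have "rev w = rev w'" using len by (intro nth_equalityI) auto
  then show ?thesis by simp
qed

lemma is_ostrowski_rep_exists: "\<exists>w. is_ostrowski_rep \<gamma> n w"
proof -
  have "\<exists>t. n < convergent_denom \<gamma> t"
  proof -
    have "k < convergent_denom \<gamma> (Suc (Suc k))" for k
    proof (induction k)
      case 0
      show ?case using convergent_denom_pos[of "Suc (Suc 0)"] by simp
    next
      case (Suc k)
      have "1 * convergent_denom \<gamma> (Suc (Suc k)) \<le>
          partial_quotient \<gamma> (Suc (Suc (Suc k))) * convergent_denom \<gamma> (Suc (Suc k))"
        using pq_pos[of "Suc (Suc k)"] by (intro mult_right_mono) auto
      then show ?case using Suc convergent_denom_pos[of "Suc k"]
        unfolding convergent_denom.simps(3)[of \<gamma> "Suc k"] by linarith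
    qed
    then show ?thesis by blast
  qed
  \<comment> \<open>Minimality of \<open>t\<close> makes the leading digit nonzero.\<close>
  define t where "t = (LEAST t. n < convergent_denom \<gamma> t)"
  have t: "n < convergent_denom \<gamma> t"
    unfolding t_def by (rule LeastI_ex) fact
  obtain e where e: "ostrowski_digits \<gamma> e t" "ostrowski_value \<gamma> e t = n"
    using ostrowski_digits_exist[OF t] by blast
  define w where "w = rev (map e [0..<t])"
  have nth: "rev w ! i = e i" if "i < t" for i using that by (simp add: w_def)
  have len: "length w = t" by (simp add: w_def)
  have "hd w \<noteq> 0" if nonempty: "w \<noteq> []"
  proof
    assume 0: "hd w = 0"
    obtain s where s: "t = Suc s" using nonempty unfolding w_def by (cases t) auto
    then have "e s = 0" using 0 by (simp add: w_def)
    then have "n = ostrowski_value \<gamma> e s" using e(2) s by simp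
    also have "\<dots> < convergent_denom \<gamma> s"
      using ostrowski_value_less ostrowski_digits_mono[OF e(1), of s] s by simp
    finally show False using not_less_Least[of s "\<lambda>t. n < convergent_denom \<gamma> t"] s by (simp add: t_def)
  qed
  then have "is_ostrowski_rep \<gamma> n w"
    unfolding is_ostrowski_rep_iff len
    using e ostrowski_digits_cong[of t "\<lambda>i. rev w ! i" e \<gamma>] nth by auto
  then show ?thesis ..
qed

lemma is_ostrowski_rep_ostrowski_rep: "is_ostrowski_rep \<gamma> n (ostrowski_rep \<gamma> n)"
  unfolding ostrowski_rep_def
proof (rule theI')
  show "\<exists>!w. is_ostrowski_rep \<gamma> n w"
    using is_ostrowski_rep_exists is_ostrowski_rep_unique by blast
qed

end

subsection \<open>The quadratic field\<close>

text \<open>The element \<open>r + s\<gamma>\<close> is inverted through its conjugate: if \<open>\<gamma>\<^sup>2 = u\<gamma> + v\<close>, then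
  \<open>(r + s\<gamma>)(r + su - s\<gamma>)\<close> is rational.\<close>

lemma rat_adjoin_quadratic:
  assumes \<gamma>: "quadratic_irrational \<gamma>" and x: "x \<in> rat_adjoin \<gamma>"
  shows "\<exists>r\<in>\<rat>. \<exists>s\<in>\<rat>. x = r + s * \<gamma>"
proof -
  have irr: "\<gamma> \<notin> \<rat>" using \<gamma> by (simp add: quadratic_irrational_def)
  obtain A B C :: int where ABC: "A \<noteq> 0" "of_int A * \<gamma>\<^sup>2 + of_int B * \<gamma> + of_int C = 0"
    using \<gamma> by (auto simp: quadratic_irrational_def)
  define u v where "u = - real_of_int B / of_int A" and "v = - real_of_int C / of_int A"
  have uv: "u \<in> \<rat>" "v \<in> \<rat>" by (auto simp: u_def v_def)
  have "of_int A * (\<gamma> * \<gamma>) = of_int A * (u * \<gamma> + v)"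
    using ABC by (simp add: u_def v_def power2_eq_square algebra_simps)
  then have sq: "\<gamma> * \<gamma> = u * \<gamma> + v" using ABC(1) by simp
  define F where "F = {x. \<exists>r\<in>\<rat>. \<exists>s\<in>\<rat>. x = r + s * \<gamma>}"
  let ?R = "ring_of_type_algebra :: real ring"
  interpret R: field ?R by rule
  have sel: "carrier ?R = UNIV" "\<one>\<^bsub>?R\<^esub> = 1" "\<zero>\<^bsub>?R\<^esub> = 0" "x \<oplus>\<^bsub>?R\<^esub> y = x + y" "x \<otimes>\<^bsub>?R\<^esub> y = x * y" for x y
    by (simp_all add: ring_of_type_algebra_def)
  have neg: "\<ominus>\<^bsub>?R\<^esub> x = - x" for x
    by (rule R.minus_equality) (simp_all add: sel)
  have inv: "inv\<^bsub>?R\<^esub> x = inverse x" if "x \<noteq> 0" for x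
    by (rule R.comm_inv_char) (use that in \<open>simp_all add: sel\<close>)
  have "x \<in> F" if "x \<in> generate_field ?R {\<gamma>}"
    using that
  proof (induction rule: generate_field.induct)
    case one
    have "(1::real) = 1 + 0 * \<gamma>" by simp
    then show ?case unfolding sel F_def using Rats_1 Rats_0 by blast
  next
    case (incl h)
    then have "h = 0 + 1 * \<gamma>" by simp
    then show ?case unfolding F_def using Rats_1 Rats_0 by blast
  next
    case (a_inv h)
    then obtain r s where "r \<in> \<rat>" "s \<in> \<rat>" "h = r + s * \<gamma>" by (auto simp: F_def)
    moreover from this have "- h = - r + (- s) * \<gamma>" by simp
    ultimately show ?case unfolding neg F_def using Rats_minus_iff by blast
  next
    case (eng_add x y)
    then obtain r s r' s' where "r \<in> \<rat>" "s \<in> \<rat>" "x = r + s * \<gamma>" "r' \<in> \<rat>" "s' \<in> \<rat>" "y = r' + s' * \<gamma>"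
      by (auto simp: F_def)
    moreover from this have "x + y = (r + r') + (s + s') * \<gamma>" by (simp add: algebra_simps)
    ultimately show ?case unfolding sel F_def using Rats_add by blast
  next
    case (eng_mult x y)
    then obtain r s r' s' where *: "r \<in> \<rat>" "s \<in> \<rat>" "x = r + s * \<gamma>" "r' \<in> \<rat>" "s' \<in> \<rat>" "y = r' + s' * \<gamma>"
      by (auto simp: F_def)
    have "x * y = r * r' + (r * s' + s * r') * \<gamma> + s * s' * (\<gamma> * \<gamma>)"
      by (simp add: * algebra_simps)
    also have "\<dots> = (r * r' + s * s' * v) + (r * s' + s * r' + s * s' * u) * \<gamma>"
      unfolding sq by (simp add: algebra_simps)
    finally have "x * y = (r * r' + s * s' * v) + (r * s' + s * r' + s * s' * u) * \<gamma>" .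
    moreover have "r * r' + s * s' * v \<in> \<rat>" "r * s' + s * r' + s * s' * u \<in> \<rat>" using * uv by auto
    ultimately show ?case unfolding sel F_def by blast
  next
    case (m_inv x)
    then obtain r s where *: "r \<in> \<rat>" "s \<in> \<rat>" "x = r + s * \<gamma>" by (auto simp: F_def)
    have x0: "x \<noteq> 0" using m_inv by (simp add: sel)
    define N where "N = r * (r + s * u) - s * s * v"
    have "x * (r + s * u - s * \<gamma>) = r * (r + s * u) + s * s * (u * \<gamma>) - s * s * (\<gamma> * \<gamma>)"
      by (simp add: * algebra_simps)
    then have xN: "x * (r + s * u - s * \<gamma>) = N"
      unfolding sq N_def by (simp add: algebra_simps)
    have N: "N \<in> \<rat>" using *(1,2) uv by (simp add: N_def)
    \<comment> \<open>Otherwise \<open>s * \<gamma>\<close> is rational, so \<open>s = 0\<close>;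
      then \<open>r = 0\<close> and \<open>x = 0\<close>.\<close>
    have "N \<noteq> 0"
    proof
      assume "N = 0"
      then have eq: "s * \<gamma> = r + s * u" using xN x0 by simp
      show False
      proof (cases "s = 0")
        case True
        then show False using eq x0 * by simp
      next
        case False
        then have "\<gamma> = s * \<gamma> / s" by simp
        then have "\<gamma> = (r + s * u) / s" unfolding eq .
        moreover have "(r + s * u) / s \<in> \<rat>" using *(1,2) uv by simp
        ultimately show False using irr by metis
      qed
    qed
    then have "x * ((r + s * u - s * \<gamma>) / N) = 1" using xN by simp
    then have "inverse x = (r + s * u - s * \<gamma>) / N" by (rule inverse_unique)
    also have "\<dots> = (r + s * u) / N + (- s / N) * \<gamma>" by (simp add: diff_divide_distrib)
    finally have "inverse x = (r + s * u) / N + (- s / N) * \<gamma>" .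
    moreover have "(r + s * u) / N \<in> \<rat>" "- s / N \<in> \<rat>" using *(1,2) uv N by simp_all
    ultimately show ?case unfolding inv[OF x0] F_def by blast
  qed
  then show ?thesis using x by (simp add: rat_adjoin_def F_def)
qed

lemma Rats_common_denominator:
  assumes "finite A" "A \<subseteq> \<rat>"
  shows "\<exists>D::int. D > 0 \<and> (\<forall>x\<in>A. real_of_int D * x \<in> \<int>)"
  using assms
proof (induction A rule: finite_induct)
  case empty
  show ?case by (intro exI[of _ 1]) simp
next
  case (insert x A)
  then obtain D :: int where D: "D > 0" "\<forall>x\<in>A. real_of_int D * x \<in> \<int>" by auto
  obtain m n :: int where mn: "n > 0" "x = of_int m / of_int n"
    using insert.prems by (metis Rats_cases' insert_subset)
  have "real_of_int (D * n) * x = of_int (D * m)" using mn by simp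
  moreover have "real_of_int (D * n) * y \<in> \<int>" if "y \<in> A" for y
    using D(2) that Ints_mult[OF Ints_of_int[of n], of "real_of_int D * y"] by (simp add: ac_simps)
  ultimately show ?case using D(1) mn(1) by (intro exI[of _ "D * n"]) (auto simp del: of_int_mult)
qed

subsection \<open>Linear conditions on pairs of representations\<close>

context periodic_cf
begin

lemma digit_sum_Q_shift:
  "digit_sum (\<lambda>k. real_of_int (Q k)) (i + P) ds =
     (of_int (Q (Suc P)) + of_int (Q P) * \<theta> 0) * digit_sum (\<lambda>k. of_int (Q k)) i ds - of_int (Q P) * digit_sum \<Delta> i ds"
proof (induction ds arbitrary: i)
  case (Cons d ds)
  have eq: "real_of_int (Q (Suc (i + P))) =
      (of_int (Q (Suc P)) + of_int (Q P) * \<theta> 0) * of_int (Q (Suc i)) - of_int (Q P) * \<Delta> (Suc i)"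
    using Q_shift[of "Suc i"] by (simp only: add_Suc)
  show ?case
    by (simp only: digit_sum.simps Cons.IH[of "Suc i", unfolded add_Suc] eq)
      (simp add: algebra_simps del: cf_denom.simps cf_error.simps)
qed simp

text \<open>Multiplying \<open>Y\<close> by \<open>\<kappa>\<close> lets \<open>Q_shift\<close>
  absorb the irrational coefficient of the first digit sum. The result is an integer
  \<open>N u\<close> plus a bounded part \<open>S 0 u\<close>, so only finitely many values of
  \<open>N u\<close> have to be tried.\<close>

lemma finite_index_linear_range:
  fixes e f :: "'l \<Rightarrow> int" and A B C E D :: int
  assumes fin: "finite \<Sigma>"
  obtains T where "finite_index \<Sigma> T"
    "\<And>u. u \<in> lists \<Sigma> \<Longrightarrow> T u \<longleftrightarrow>
       (let Y = (of_int A + of_int B * \<theta> 0) * of_int (digit_sum Q 0 (map e u)) + of_int C + of_int E * \<theta> 0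
              - of_int D * of_int (digit_sum Q 0 (map f u))
        in 0 \<le> Y \<and> Y < of_int D)"
proof -
  define \<kappa> where "\<kappa> = Q P"
  have \<kappa>: "\<kappa> \<ge> 1" using Q_Suc_pos[of "P - 1"] P_pos by (simp add: \<kappa>_def del: cf_denom.simps)
  define Y where "Y u = (of_int A + of_int B * \<theta> 0) * of_int (digit_sum Q 0 (map e u)) + of_int C + of_int E * \<theta> 0
              - of_int D * of_int (digit_sum Q 0 (map f u))" for u
  \<comment> \<open>The shifted sum of \<open>H\<close> brings in an extra
    \<open>B * Q (Suc P)\<close> times the sum of \<open>e\<close>, which is subtracted
    here.\<close>
  define F where "F l = (\<kappa> * A - B * Q (Suc P)) * e l + (- (\<kappa> * D)) * f l" for l
  define H where "H l = B * e l" for l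
  have FH: "F = (\<lambda>l. (\<kappa> * A - B * Q (Suc P)) * e l + (- (\<kappa> * D)) * f l)" "H = (\<lambda>l. B * e l)"
    by (auto simp: F_def H_def)
  define N where "N u = digit_sum Q 0 (map F u) + digit_sum Q P (map H u)" for u
  \<comment> \<open>Since \<open>\<Delta> 0 = - 1\<close> and
    \<open>\<Delta> 1 = \<theta> 0\<close>, the last two terms add \<open>\<kappa> * C + m\<close>
    and \<open>\<kappa> * E * \<theta> 0\<close>.\<close>
  define S where "S m u = digit_sum \<Delta> 0 (map (\<lambda>l. \<kappa> * H l) u) + of_int (- (\<kappa> * C + m)) * \<Delta> 0 + of_int (\<kappa> * E) * \<Delta> 1" for m u
  have Y_eq: "of_int \<kappa> * Y u = of_int (N u) + S 0 u" for u
  proof -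
    have "real_of_int (N u) = of_int (\<kappa> * A - B * Q (Suc P)) * of_int (digit_sum Q 0 (map e u))
        + of_int (- (\<kappa> * D)) * of_int (digit_sum Q 0 (map f u))
        + ((of_int (Q (Suc P)) + of_int \<kappa> * \<theta> 0) * (of_int B * of_int (digit_sum Q 0 (map e u)))
           - of_int \<kappa> * digit_sum \<Delta> 0 (map H u))"
      unfolding N_def of_int_add of_int_digit_sum digit_sum_Q_shift[of 0, unfolded add_0] \<kappa>_def[symmetric]
      by (simp only: FH digit_sum_add digit_sum_scale)
    moreover have "S 0 u = of_int \<kappa> * digit_sum \<Delta> 0 (map H u) + of_int \<kappa> * (of_int C + of_int E * \<theta> 0)"
      by (simp add: S_def digit_sum_scale[of _ _ \<kappa> H] algebra_simps)
    ultimately show ?thesis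
      unfolding Y_def by (simp add: algebra_simps del: cf_denom.simps)
  qed
  have S_shift: "S m u = S 0 u + of_int m" for m u by (simp add: S_def)
  obtain M where M: "M \<ge> 0" "\<And>u. u \<in> lists \<Sigma> \<Longrightarrow> \<forall>d\<in>set (map (\<lambda>l. \<kappa> * H l) u). real_of_int \<bar>d\<bar> \<le> M"
    using finite_digit_bound[OF fin] by blast
  define K where "K = \<lceil>2 * M + \<bar>of_int (\<kappa> * C)\<bar> + \<bar>of_int (\<kappa> * E)\<bar> + of_int (\<kappa> * D)\<rceil>"
  have S_bound: "\<bar>S 0 u\<bar> \<le> 2 * M + \<bar>of_int (\<kappa> * C)\<bar> + \<bar>of_int (\<kappa> * E)\<bar>" if u: "u \<in> lists \<Sigma>" for u
  proof -
    have "\<bar>digit_sum \<Delta> 0 (map (\<lambda>l. \<kappa> * H l) u)\<bar> \<le> 2 * M"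
      using abs_digit_sum_\<Delta>_le[OF M(2)[OF u] M(1), of 0] by simp
    moreover have "\<bar>of_int (\<kappa> * E) * \<Delta> 1\<bar> \<le> \<bar>of_int (\<kappa> * E)\<bar>"
      using mult_left_mono[OF abs_\<Delta>_le_1[of 1], of "\<bar>of_int (\<kappa> * E)\<bar>"] by (simp only: abs_mult abs_ge_zero mult_1_right)
    moreover have "of_int (- (\<kappa> * C + 0)) * \<Delta> 0 = of_int (\<kappa> * C)" by simp
    ultimately show ?thesis unfolding S_def by linarith
  qed
  define T where "T u \<longleftrightarrow> (\<exists>m\<in>{-K..K}. N u = m \<and> (S m u \<ge> 0 \<and> \<not> S (m - \<kappa> * D) u \<ge> 0))" for u
  have "finite_index \<Sigma> T"
    unfolding T_def
    by (intro finite_index_Bex finite_index_conj finite_index_not finite_atLeastAtMost_int)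
      (unfold N_def S_def, (rule finite_index_Q_sum_eq[OF fin] finite_index_\<Delta>_sum_nonneg[OF fin])+)
  moreover have "T u \<longleftrightarrow> 0 \<le> Y u \<and> Y u < of_int D" if u: "u \<in> lists \<Sigma>" for u
  proof -
    have "0 \<le> Y u \<and> Y u < of_int D \<longleftrightarrow> 0 \<le> of_int \<kappa> * Y u \<and> of_int \<kappa> * Y u < of_int \<kappa> * of_int D"
      using \<kappa> by (simp add: zero_le_mult_iff)
    also have "\<dots> \<longleftrightarrow> 0 \<le> S 0 u + of_int (N u) \<and> S 0 u + of_int (N u) < of_int (\<kappa> * D)"
      unfolding Y_eq by (simp add: add.commute)
    also have "\<dots> \<longleftrightarrow> T u"
    proof
      assume *: "0 \<le> S 0 u + of_int (N u) \<and> S 0 u + of_int (N u) < of_int (\<kappa> * D)"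
      then have "\<bar>real_of_int (N u)\<bar> \<le> 2 * M + \<bar>of_int (\<kappa> * C)\<bar> + \<bar>of_int (\<kappa> * E)\<bar> + of_int (\<kappa> * D)"
        using S_bound[OF u] by linarith
      then have "N u \<in> {-K..K}" unfolding K_def by (simp only: atLeastAtMost_iff) linarith
      then show "T u"
        unfolding T_def using * S_shift[of "N u" u] S_shift[of "N u - \<kappa> * D" u] by simp
    next
      assume "T u"
      then have "S (N u) u \<ge> 0 \<and> \<not> S (N u - \<kappa> * D) u \<ge> 0" by (auto simp: T_def)
      then show "0 \<le> S 0 u + of_int (N u) \<and> S 0 u + of_int (N u) < of_int (\<kappa> * D)"
        using S_shift[of "N u" u] S_shift[of "N u - \<kappa> * D" u] by simp
    qed
    finally show ?thesis by blast
  qed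
  ultimately show thesis using that unfolding Y_def Let_def by blast
qed

end

section \<open>Values of padded representations, and the synchronizing automaton\<close>

lemma digit_sum_pad_zeros:
  assumes rep: "is_ostrowski_rep \<gamma> n w"
    and S: "\<And>i. S (Suc i) = int (convergent_denom \<gamma> i)"
  shows "digit_sum S 0 (map int (rev (pad_zeros k w))) = int n"
proof -
  have zeros: "digit_sum S i (replicate m 0) = 0" for i m
    using digit_sum_zeros[of S i m "[]"] by simp
  have n: "n = ostrowski_value \<gamma> (\<lambda>i. rev w ! i) (length w)"
    using rep unfolding is_ostrowski_rep_iff by blast
  have "digit_sum S 0 (map int (rev (pad_zeros k w))) = digit_sum S 0 (map int (rev w))"
    by (simp add: pad_zeros_def digit_sum_append zeros)
  also have "\<dots> = int n"
    unfolding digit_sum_eq_sum by (subst n) (simp add: S)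
  finally show ?thesis .
qed

lemma set_ostrowski_rep_subset:
  assumes rep: "is_ostrowski_rep \<gamma> n w"
    and M: "\<And>i. partial_quotient \<gamma> (Suc i) \<le> M"
  shows "set w \<subseteq> {..M}"
proof
  fix d assume "d \<in> set w"
  then obtain i where i: "i < length w" "d = rev w ! i"
    by (metis in_set_conv_nth length_rev set_rev)
  have "ostrowski_digits \<gamma> (\<lambda>i. rev w ! i) (length w)"
    using rep unfolding is_ostrowski_rep_iff by blast
  from ostrowski_digits_le[OF this i(1)] show "d \<in> {..M}" using M[of i] i(2) by simp
qed

lemma eq_nat_floor_iff:
  fixes x :: real
  assumes "x \<ge> 0"
  shows "y = nat \<lfloor>x\<rfloor> \<longleftrightarrow> 0 \<le> x - real y \<and> x - real y < 1"
proof -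
  have "y = nat \<lfloor>x\<rfloor> \<longleftrightarrow> \<lfloor>x\<rfloor> = int y" using assms by auto
  also have "\<dots> \<longleftrightarrow> 0 \<le> x - real y \<and> x - real y < 1" unfolding floor_eq_iff by auto
  finally show ?thesis .
qed

theorem theorem9:
  fixes \<gamma> \<alpha> \<beta> :: real and P :: nat and a :: "nat \<Rightarrow> nat"
  assumes "0 < \<gamma>" and "\<gamma> < 1" and "quadratic_irrational \<gamma>"
    and "P \<ge> 1" and "\<And>i. 1 \<le> i \<Longrightarrow> i \<le> P \<Longrightarrow> a i > 0"
    and "partial_quotient \<gamma> 0 = 0"
    and "\<And>i. i \<ge> 1 \<Longrightarrow> partial_quotient \<gamma> i = a ((i - 1) mod P + 1)"
    and "\<alpha> \<in> rat_adjoin \<gamma>" and "\<beta> \<in> rat_adjoin \<gamma>"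
    and "\<alpha> \<ge> 0" and "\<alpha> + \<beta> \<ge> 0"
  shows "ostrowski_synchronized \<gamma> (\<lambda>n. nat \<lfloor>real n * \<alpha> + \<beta>\<rfloor>)"
proof -
  have pq: "partial_quotient \<gamma> (Suc k) = a (k mod P + 1)" for k
    using assms(7)[of "Suc k"] by simp
  have in_range: "1 \<le> k mod P + 1" "k mod P + 1 \<le> P" for k
    using assms(4) mod_less_divisor[of P k] by (auto intro!: Suc_leI)
  have pq_pos: "partial_quotient \<gamma> (Suc k) > 0" for k
    unfolding pq using assms(5) in_range by blast
  define M where "M = (\<Sum>i=1..P. a i)"
  have pq_le: "partial_quotient \<gamma> (Suc k) \<le> M" for k
    unfolding pq M_def using in_range[of k] by (intro member_le_sum) auto
  define \<Sigma> :: "(nat \<times> nat) set" where "\<Sigma> = {..M} \<times> {..M}"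
  have fin: "finite \<Sigma>" by (simp add: \<Sigma>_def)

  define b where "b k = int (partial_quotient \<gamma> (Suc k))" for k
  define \<theta> where "\<theta> k = frac (complete_quotient \<gamma> k)" for k
  have frac_irr: "frac x \<notin> \<rat>" if "x \<notin> \<rat>" for x :: real
    using that by (metis Rats_add Rats_of_int frac_def diff_add_cancel)
  have cq_irr: "complete_quotient \<gamma> k \<notin> \<rat>" for k
  proof (induction k)
    case 0
    then show ?case using assms(3) by (simp add: quadratic_irrational_def)
  next
    case (Suc k)
    show ?case
    proof
      assume "complete_quotient \<gamma> (Suc k) \<in> \<rat>"
      then have "1 / complete_quotient \<gamma> (Suc k) \<in> \<rat>" by (intro Rats_divide Rats_1)
      then show False using frac_irr[OF Suc] by simp
    qed
  qed
  have \<theta>: "0 < \<theta> k" "\<theta> k < 1" for k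
  proof -
    have "\<theta> k \<noteq> 0" unfolding \<theta>_def using frac_irr[OF cq_irr[of k]] by (metis Rats_0)
    then show "0 < \<theta> k" using frac_ge_0[of "complete_quotient \<gamma> k"] by (simp add: \<theta>_def)
    show "\<theta> k < 1" by (simp add: \<theta>_def frac_lt_1)
  qed
  have "\<theta> k * (of_int (b k) + \<theta> (Suc k)) = 1" for k
  proof -
    have cq: "complete_quotient \<gamma> (Suc k) = 1 / \<theta> k" by (simp add: \<theta>_def)
    then have "complete_quotient \<gamma> (Suc k) \<ge> 0" using \<theta>(1)[of k] by simp
    then have "b k = \<lfloor>complete_quotient \<gamma> (Suc k)\<rfloor>"
      unfolding b_def partial_quotient_def by simp
    then have "of_int (b k) + \<theta> (Suc k) = complete_quotient \<gamma> (Suc k)"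
      by (simp only: \<theta>_def frac_def)
    then show ?thesis using \<theta>(1)[of k] unfolding cq by simp
  qed
  then interpret periodic_cf b P \<theta>
    using pq_pos assms(4) \<theta> by unfold_locales (auto simp: b_def pq Suc_le_eq)

  have Q_denom: "Q (Suc i) = int (convergent_denom \<gamma> i)" for i
  proof (induction i rule: less_induct)
    case (less i)
    consider "i = 0" | "i = 1" | j where "i = Suc (Suc j)"
      by (metis One_nat_def nat.exhaust)
    then show ?case
    proof cases
      case (3 j)
      then show ?thesis using less[of j] less[of "Suc j"] by (simp add: b_def)
    qed (simp_all add: b_def)
  qed
  have "\<lfloor>\<gamma>\<rfloor> = 0" using assms(1,2) by (simp add: floor_eq_iff)
  then have \<theta>0: "\<theta> 0 = \<gamma>" by (simp add: \<theta>_def frac_def)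

  obtain r s where rs: "r \<in> \<rat>" "s \<in> \<rat>" "\<alpha> = r + s * \<gamma>"
    using rat_adjoin_quadratic[OF assms(3,8)] by blast
  obtain r' s' where rs': "r' \<in> \<rat>" "s' \<in> \<rat>" "\<beta> = r' + s' * \<gamma>"
    using rat_adjoin_quadratic[OF assms(3,9)] by blast
  obtain D :: int where D: "D > 0" "\<forall>x\<in>{r, s, r', s'}. real_of_int D * x \<in> \<int>"
    using Rats_common_denominator[of "{r, s, r', s'}"] rs rs' by auto
  then obtain A B C E :: int where ABCE: "of_int D * r = of_int A" "of_int D * s = of_int B"
    "of_int D * r' = of_int C" "of_int D * s' = of_int E"
    by (auto elim!: Ints_cases)

  obtain T where T: "finite_index \<Sigma> T" "\<And>u. u \<in> lists \<Sigma> \<Longrightarrow> T u \<longleftrightarrow>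
       (let Y = (of_int A + of_int B * \<theta> 0) * of_int (digit_sum Q 0 (map (\<lambda>l. int (fst l)) u)) + of_int C + of_int E * \<theta> 0
              - of_int D * of_int (digit_sum Q 0 (map (\<lambda>l. int (snd l)) u))
        in 0 \<le> Y \<and> Y < of_int D)"
    using finite_index_linear_range[OF fin, where A = A and B = B and C = C and E = E and D = D
      and e = "\<lambda>l. int (fst l)" and f = "\<lambda>l. int (snd l)"] by blast
  \<comment> \<open>\<open>T\<close> reads the least significant digit first, the automaton the most
    significant one, hence the reversal.\<close>
  obtain \<A> :: "(nat, nat \<times> nat) dfa" where \<A>: "is_dfa \<A>" "alphabet \<A> = \<Sigma>"
    "\<And>w. w \<in> lists \<Sigma> \<Longrightarrow> accepts \<A> w \<longleftrightarrow> T (rev w)"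
    using finite_index_dfa_rev[OF fin T(1)] by blast

  show ?thesis
    unfolding ostrowski_synchronized_def
  proof (intro exI[of _ \<A>] conjI allI impI)
    fix n y :: nat assume n: "n \<ge> 1"
    define u v where "u = ostrowski_rep \<gamma> n" and "v = ostrowski_rep \<gamma> y"
    define k where "k = max (length u) (length v)"
    define w where "w = ostrowski_pair_rep \<gamma> n y"
    have w: "w = zip (pad_zeros k u) (pad_zeros k v)"
      by (simp add: w_def ostrowski_pair_rep_def u_def v_def k_def Let_def)
    have u: "is_ostrowski_rep \<gamma> n u" and v: "is_ostrowski_rep \<gamma> y v"
      unfolding u_def v_def by (rule is_ostrowski_rep_ostrowski_rep, rule pq_pos)+
    have len: "length (pad_zeros k u) = k" "length (pad_zeros k v) = k"
      by (auto simp: pad_zeros_def k_def)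
    have "set (pad_zeros k u) \<subseteq> {..M}" "set (pad_zeros k v) \<subseteq> {..M}"
      using set_ostrowski_rep_subset[OF u pq_le] set_ostrowski_rep_subset[OF v pq_le]
      by (auto simp: pad_zeros_def)
    then have w_lists: "w \<in> lists \<Sigma>"
      by (auto simp: w \<Sigma>_def dest: set_zip_leftD set_zip_rightD)
    then show "ostrowski_pair_rep \<gamma> n y \<in> lists (alphabet \<A>)" by (simp add: \<A>(2) w_def)
    have rev_lists: "rev w \<in> lists \<Sigma>" using w_lists by auto
    have "map (\<lambda>l. int (fst l)) (rev w) = map int (rev (map fst w))"
      "map (\<lambda>l. int (snd l)) (rev w) = map int (rev (map snd w))"
      by (simp_all add: rev_map)
    then have sums: "digit_sum Q 0 (map (\<lambda>l. int (fst l)) (rev w)) = int n"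
      "digit_sum Q 0 (map (\<lambda>l. int (snd l)) (rev w)) = int y"
      using digit_sum_pad_zeros[OF u Q_denom] digit_sum_pad_zeros[OF v Q_denom] len
      by (simp_all add: w)
    \<comment> \<open>As \<open>n \<ge> 1\<close>, the value is at least
      \<open>\<alpha> + \<beta>\<close>, so \<open>nat\<close> does not truncate the floor.\<close>
    have "real n * \<alpha> + \<beta> \<ge> 0"
      using mult_right_mono[of 1 "real n" \<alpha>] n assms(10,11) by simp
    then have "y = nat \<lfloor>real n * \<alpha> + \<beta>\<rfloor> \<longleftrightarrow>
        0 \<le> real n * \<alpha> + \<beta> - real y \<and> real n * \<alpha> + \<beta> - real y < 1"
      by (rule eq_nat_floor_iff)
    also have "\<dots> \<longleftrightarrow> 0 \<le> of_int D * (real n * \<alpha> + \<beta> - real y) \<and>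
        of_int D * (real n * \<alpha> + \<beta> - real y) < of_int D"
      using D(1) by (simp add: zero_le_mult_iff)
    also have "of_int D * (real n * \<alpha> + \<beta> - real y) =
        (of_int D * r + of_int D * s * \<gamma>) * real n + of_int D * r' + of_int D * s' * \<gamma> - of_int D * real y"
      by (simp add: rs(3) rs'(3) algebra_simps)
    also have "0 \<le> \<dots> \<and> \<dots> < of_int D \<longleftrightarrow> T (rev w)"
      using T(2)[OF rev_lists] by (simp add: Let_def sums \<theta>0 ABCE)
    finally show "accepts \<A> (ostrowski_pair_rep \<gamma> n y) \<longleftrightarrow> y = nat \<lfloor>real n * \<alpha> + \<beta>\<rfloor>"
      using \<A>(3)[OF w_lists] by (simp add: w_def)
  qed (rule \<A>(1))
qed

end
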